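(* Let $K$ be an irreducible symmetric cone in a finite-dimensional Euclidean space $E$, and let $F$ be a self-scaled barrier function defined on $\operatorname{int}(K)$. Then there exist constants $\alpha>0$ and $\beta\in\mathbb{R}$ such that $$F(x)=\alpha\, U(x)+\beta\qquad\text{for all }x\in\operatorname{int}(K),$$ where $U$ is the universal barrier function on $\operatorname{int}(K)$.
   Context: Cones. A cone $K$ in a finite-dimensional Euclidean space $(E,\langle\cdot,\cdot\rangle)$ is regular if it is closed, convex, pointed (contains no line) and solid (non-empty interior). Its dual cone is $K^*=\{s\in E:\langle x,s\rangle\ge 0\ \forall x\in K\}$. $\operatorname{Aut}(K)=\{A\in \mathrm{GL}(E):A(K)=K\}$. A regular cone $K$ is symmetric (homogeneous self-dual) if $\operatorname{Aut}(K)$ acts transitively on $\operatorname{int}(K)$ and $E$ can be endowed with an inner product for which $K^*=K$. A pointed convex cone $K$ is irreducible if there are no $m\ge2$, non-zero subspaces $E_1,\dots,E_m$ with $E=E_1\oplus\cdots\oplus E_m$, and cones $K_i\subseteq E_i$ with $K=K_1+\cdots+K_m$. Universal barrier. The characteristic function of $K$ is $\varphi_K(x)=\int_{K^*}e^{-\langle x,y\rangle}\,dy$, $x\in\operatorname{int}(K)$. The universal barrier function of Nesterov and Nemirovskii is $U(x)=c_1\ln\varphi_K(x)+c_2$ for certain constants $c_1>0$ and $c_2$ (whose values are immaterial here). Self-scaled barriers. A function $F:\operatorname{int}(K)\to\mathbb{R}$ is a self-concordant barrier if it is $C^3$, convex, $F(x_k)\to\infty$ whenever $x_k\in\operatorname{int}(K)$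 converges to a boundary point of $K$, $|D^3F(x)[h,h,h]|\le 2\,(D^2F(x)[h,h])^{3/2}$ for all $x\in\operatorname{int}(K)$, $h\in E$, and $|DF(x)[h]|^2\le\nu\, D^2F(x)[h,h]$ for some constant $\nu$. The Hessian $F''(x)$ is the symmetric operator with $\langle F''(x)u,v\rangle=D^2F(x)[u,v]$. A self-concordant barrier $F$ is self-scaled if $F''(x)$ is non-singular for all $x\in\operatorname{int}(K)$, there is $\nu>0$ with $F(tx)=F(x)-\nu\ln t$ for all $x\in\operatorname{int}(K)$, $t>0$, and for all $x,w\in\operatorname{int}(K)$: $F''(w)x\in\operatorname{int}(K^* )$ and $F_*(F''(w)x)=F(x)-2F(w)-\nu$, where $F_*(s)=\sup\{-\langle x,s\rangle-F(x):x\in\operatorname{int}(K)\}$ for $s\in\operatorname{int}(K^* )$. *)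

theory Defs
  imports "HOL-Analysis.Analysis"
begin

definition pointed_cone :: "'a::real_vector set \<Rightarrow> bool" where
  "pointed_cone K \<longleftrightarrow> \<not> (\<exists>a d. d \<noteq> 0 \<and> range (\<lambda>t::real. a + t *\<^sub>R d) \<subseteq> K)"

definition regular_cone :: "'a::euclidean_space set \<Rightarrow> bool" where
  "regular_cone K \<longleftrightarrow> convex_cone K \<and> closed K \<and> pointed_cone K \<and> interior K \<noteq> {}"

definition is_inner_product :: "('a::real_vector \<Rightarrow> 'a \<Rightarrow> real) \<Rightarrow> bool" where
  "is_inner_product B \<longleftrightarrow>
     bilinear B \<and> (\<forall>x y. B x y = B y x) \<and> (\<forall>x. x \<noteq> 0 \<longrightarrow> B x x > 0)"

definition dual_cone_wrt :: "('a \<Rightarrow> 'a \<Rightarrow> real) \<Rightarrow> 'a set \<Rightarrow> 'a set" where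
  "dual_cone_wrt B K = {s. \<forall>x\<in>K. B x s \<ge> 0}"

abbreviation dual_cone :: "'a::real_inner set \<Rightarrow> 'a set" where
  "dual_cone \<equiv> dual_cone_wrt (\<bullet>)"

definition Aut_cone :: "'a::real_vector set \<Rightarrow> ('a \<Rightarrow> 'a) set" where
  "Aut_cone K = {A. linear A \<and> bij A \<and> A ` K = K}"

text \<open>The inner product making \<open>K\<close> self-dual need not be the given one of the ambient space.\<close>

definition symmetric_cone :: "'a::euclidean_space set \<Rightarrow> bool" where
  "symmetric_cone K \<longleftrightarrow> regular_cone K \<and>
     (\<forall>x\<in>interior K. \<forall>y\<in>interior K. \<exists>A\<in>Aut_cone K. A x = y) \<and>
     (\<exists>B. is_inner_product B \<and> dual_cone_wrt B K = K)"

text \<open>The whole space is the internal direct sum of \<open>E 0, \<dots>, E (m - 1)\<close>; the values of the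
  components \<open>y i\<close> for \<open>i \<ge> m\<close> are pinned to \<open>0\<close> only to make uniqueness meaningful.\<close>

definition direct_sum_decomp :: "nat \<Rightarrow> (nat \<Rightarrow> 'a::real_vector set) \<Rightarrow> bool" where
  "direct_sum_decomp m E \<longleftrightarrow> (\<forall>i<m. subspace (E i)) \<and>
     (\<forall>x. \<exists>!y. (\<forall>i<m. y i \<in> E i) \<and> (\<forall>i\<ge>m. y i = 0) \<and> x = (\<Sum>i<m. y i))"

definition irreducible_cone :: "'a::real_vector set \<Rightarrow> bool" where
  "irreducible_cone K \<longleftrightarrow> convex_cone K \<and> pointed_cone K \<and>
     \<not> (\<exists>(m::nat) E C. m \<ge> 2 \<and> direct_sum_decomp m E \<and>
          (\<forall>i<m. E i \<noteq> {0} \<and> cone (C i) \<and> C i \<subseteq> E i) \<and>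
          K = {\<Sum>i<m. y i | y. \<forall>i<m. y i \<in> C i})"

definition char_fun :: "'a::euclidean_space set \<Rightarrow> 'a \<Rightarrow> real" where
  "char_fun K x = (LINT y:dual_cone K|lborel. exp (- (x \<bullet> y)))"

definition universal_barrier :: "real \<Rightarrow> real \<Rightarrow> 'a::euclidean_space set \<Rightarrow> 'a \<Rightarrow> real" where
  "universal_barrier c1 c2 K x = c1 * ln (char_fun K x) + c2"

text \<open>Barriers are total functions of which only the values on the open set \<open>interior K\<close> matter:
  derivatives at interior points depend only on the function near the point.
  For a function of class \<open>C\<^sup>3\<close> near \<open>x\<close>, \<open>D1 F x h\<close>, \<open>D2 F x h k\<close>, \<open>D3 F x h k l\<close> are the values
  at the indicated directions of the first three Frechet derivatives at \<open>x\<close>.\<close>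

definition D1 :: "('a::real_normed_vector \<Rightarrow> real) \<Rightarrow> 'a \<Rightarrow> 'a \<Rightarrow> real" where
  "D1 F x h = frechet_derivative F (at x) h"

definition D2 :: "('a::real_normed_vector \<Rightarrow> real) \<Rightarrow> 'a \<Rightarrow> 'a \<Rightarrow> 'a \<Rightarrow> real" where
  "D2 F x h k = D1 (\<lambda>y. D1 F y h) x k"

definition D3 :: "('a::real_normed_vector \<Rightarrow> real) \<Rightarrow> 'a \<Rightarrow> 'a \<Rightarrow> 'a \<Rightarrow> 'a \<Rightarrow> real" where
  "D3 F x h k l = D1 (\<lambda>y. D2 F y h k) x l"

text \<open>Functions of class \<open>C\<^sup>n\<close> on an open set \<open>S\<close> of a finite-dimensional space. Continuity of the
  \<open>n\<close>-th derivative is required along each tuple of directions, which in finite dimension is the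
  same as continuity in operator norm.\<close>

primrec Ck_on :: "nat \<Rightarrow> 'a::euclidean_space set \<Rightarrow> ('a \<Rightarrow> real) \<Rightarrow> bool" where
  "Ck_on 0 S F \<longleftrightarrow> continuous_on S F"
| "Ck_on (Suc n) S F \<longleftrightarrow>
     (\<forall>x\<in>S. F differentiable (at x)) \<and> (\<forall>h. Ck_on n S (\<lambda>x. D1 F x h))"

definition self_concordant_barrier :: "'a::euclidean_space set \<Rightarrow> ('a \<Rightarrow> real) \<Rightarrow> bool" where
  "self_concordant_barrier K F \<longleftrightarrow>
     Ck_on 3 (interior K) F \<and>
     convex_on (interior K) F \<and>
     (\<forall>X x. (\<forall>n::nat. X n \<in> interior K) \<and> X \<longlonglongrightarrow> x \<and> x \<in> frontier K
        \<longrightarrow> filterlim (\<lambda>n. F (X n)) at_top sequentially) \<and>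
     (\<forall>x\<in>interior K. \<forall>h. \<bar>D3 F x h h h\<bar> \<le> 2 * (D2 F x h h) powr (3/2)) \<and>
     (\<exists>\<nu>. \<forall>x\<in>interior K. \<forall>h. \<bar>D1 F x h\<bar>\<^sup>2 \<le> \<nu> * D2 F x h h)"

text \<open>The defining identity determines the operator and makes it linear and symmetric as soon as
  \<open>D2 F x\<close> is a symmetric bilinear form.\<close>

definition hessian :: "('a::euclidean_space \<Rightarrow> real) \<Rightarrow> 'a \<Rightarrow> 'a \<Rightarrow> 'a" where
  "hessian F x = (THE A. \<forall>u v. A u \<bullet> v = D2 F x u v)"

lemma inner_hessian:
  assumes "\<And>u. (\<lambda>y. D1 F y u) differentiable (at x)"
  shows "hessian F x u \<bullet> v = D2 F x u v"
proof -
  let ?A = "\<lambda>u. \<Sum>b\<in>Basis. D2 F x u b *\<^sub>R b"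
  have A: "\<forall>u v. ?A u \<bullet> v = D2 F x u v"
  proof (intro allI)
    fix u v
    have lin: "linear (D2 F x u)"
      using linear_frechet_derivative[OF assms[of u]] by (simp add: D2_def[abs_def] D1_def[abs_def])
    have "D2 F x u v = D2 F x u (\<Sum>b\<in>Basis. (v \<bullet> b) *\<^sub>R b)"
      by (simp add: euclidean_representation)
    also have "\<dots> = (\<Sum>b\<in>Basis. (v \<bullet> b) * D2 F x u b)"
      by (simp add: linear_sum[OF lin] linear_cmul[OF lin])
    finally show "?A u \<bullet> v = D2 F x u v"
      by (simp add: inner_sum_left inner_commute[of v] mult.commute)
  qed
  have "B = ?A" if "\<forall>u v. B u \<bullet> v = D2 F x u v" for B
    using that A by (metis (no_types, lifting) ext vector_eq_rdot)
  then have "hessian F x = ?A"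
    unfolding hessian_def using A by (intro the_equality) blast+
  then show ?thesis using A by simp
qed

text \<open>Valued in the extended reals, so that no convention about unbounded suprema enters.\<close>

definition conjugate_barrier :: "'a::euclidean_space set \<Rightarrow> ('a \<Rightarrow> real) \<Rightarrow> 'a \<Rightarrow> ereal" where
  "conjugate_barrier K F s = (SUP x\<in>interior K. ereal (- (x \<bullet> s) - F x))"

definition self_scaled_barrier :: "'a::euclidean_space set \<Rightarrow> ('a \<Rightarrow> real) \<Rightarrow> bool" where
  "self_scaled_barrier K F \<longleftrightarrow>
     self_concordant_barrier K F \<and>
     (\<forall>x\<in>interior K. bij (hessian F x)) \<and>
     (\<exists>\<nu>>0. (\<forall>x\<in>interior K. \<forall>t>0. F (t *\<^sub>R x) = F x - \<nu> * ln t) \<and>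
        (\<forall>x\<in>interior K. \<forall>w\<in>interior K.
           hessian F w x \<in> interior (dual_cone K) \<and>
           conjugate_barrier K F (hessian F w x) = ereal (F x - 2 * F w - \<nu>)))"

end

theory Submission
  imports Defs
begin

text \<open>
Write \<open>H x\<close> for the Hessian operator of the barrier \<open>F\<close> at \<open>x\<close>, and \<open>g\<close> and \<open>M\<close> for the gradient and
the Hessian operator of \<open>ln \<phi>\<close>, where \<open>\<phi>\<close> is the characteristic function of \<open>K\<close>. The theorem says that
\<open>g\<close> is a constant multiple of the gradient of \<open>F\<close>. The proof compares \<open>M\<close> with \<open>H\<close> by means of the
automorphisms of \<open>K\<close> that a self-scaled barrier produces.

\<^item> For \<open>x\<close> and \<open>w\<close> in the interior of \<open>K\<close>, the operator \<open>Q = (H x)\<^sup>-\<^sup>1 (H w)\<close> is an automorphism of \<open>K\<close>,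
  because every \<open>H w\<close> maps the interior of \<open>K\<close> onto the interior of the dual cone (\<open>H_image\<close>). With
  \<open>x\<close> fixed and \<open>w\<close> varying they move \<open>x\<close> to every interior point, because an interior point and an
  interior dual point always have a scaling point (\<open>scaling_point\<close>).

\<^item> An automorphism \<open>A\<close> changes \<open>\<phi>\<close> by a constant factor (\<open>char_fun_automorphism_ratio\<close>); hence \<open>M\<close>
  is equivariant, \<open>\<langle>M (A z) (A k), A l\<rangle> = \<langle>M z k, l\<rangle>\<close>.

\<^item> Take \<open>A = (H x)\<^sup>-\<^sup>1 (H w)\<close> and \<open>z = x\<close>, and differentiate in \<open>w\<close> at \<open>w = x\<close>. The resulting formula
  expresses the derivative of \<open>M\<close> through that of \<open>H\<close> and through \<open>T = (H x)\<^sup>-\<^sup>1 (M x)\<close>. Third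
  derivatives are symmetric in all their arguments, and this alone forces \<open>M' = H' T\<close>, so \<open>T\<close> does not
  depend on \<open>x\<close> (\<open>hessian_quotient_constant\<close>).

\<^item> The operator \<open>T\<close> is self-adjoint for the inner product given by \<open>H x\<close>, for every \<open>x\<close>, and therefore
  commutes with the automorphisms above. So does the projection onto an eigenspace of \<open>T\<close>, and a
  projection commuting with a transitive family of automorphisms maps \<open>K\<close> into itself
  (\<open>projection_preserves_cone\<close>). Together with the complementary projection it splits \<open>K\<close>. Since \<open>K\<close> is
  irreducible, \<open>T\<close> is a scalar \<open>r\<close>.

\<^item> By homogeneity each gradient is minus the Hessian applied to the base point, so \<open>M x = r H x\<close> gives
  \<open>ln \<phi> = r F + c\<close>, and comparing radial derivatives gives \<open>r > 0\<close>.
\<close>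

section \<open>First and second derivatives along directions\<close>

lemma D1_unique: "(f has_derivative f') (at x) \<Longrightarrow> D1 f x = f'"
  by (rule ext) (simp add: D1_def frechet_derivative_at[symmetric])

lemma D1_works: "f differentiable (at x) \<Longrightarrow> (f has_derivative D1 f x) (at x)"
  by (simp add: D1_def[abs_def] frechet_derivative_works)

text \<open>The mean value theorem in the direction \<open>h\<close> turns the second difference into a difference of values
of \<open>D1 f\<close>, both taken within distance \<open>O(t)\<close> of \<open>x\<close>, where differentiability at the single point \<open>x\<close>
controls them. The quotient is symmetric in \<open>h\<close> and \<open>k\<close>, which makes its limit symmetric.\<close>

lemma second_difference_tendsto:
  fixes f :: "'a::real_normed_vector \<Rightarrow> real"
  assumes S: "open S" "x \<in> S" and f: "\<And>y. y \<in> S \<Longrightarrow> f differentiable (at y)"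
    and G: "(\<lambda>y. D1 f y h) differentiable (at x)"
  shows "((\<lambda>t. (f (x + t *\<^sub>R h + t *\<^sub>R k) - f (x + t *\<^sub>R h) - f (x + t *\<^sub>R k) + f x) / t\<^sup>2)
           \<longlongrightarrow> D2 f x h k) (at_right 0)"
proof (rule tendstoI)
  fix e :: real assume e: "e > 0"
  define N where "N = norm h + norm k"
  have N: "N \<ge> 0" by (simp add: N_def)
  define \<epsilon> where "\<epsilon> = e / (2 * N + 1)"
  have \<epsilon>: "\<epsilon> > 0" "2 * \<epsilon> * N < e"
    using e N by (auto simp: \<epsilon>_def field_simps)
  have dG: "((\<lambda>y. D1 f y h) has_derivative D2 f x h) (at x)"
    using D1_works[OF G] by (simp add: D2_def[abs_def])
  then obtain d1 where d1: "d1 > 0"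
    "\<And>y. norm (y - x) < d1 \<Longrightarrow> norm (D1 f y h - D1 f x h - D2 f x h (y - x)) \<le> \<epsilon> * norm (y - x)"
    using \<epsilon>(1) unfolding has_derivative_at_alt by blast
  obtain d2 where d2: "d2 > 0" "ball x d2 \<subseteq> S"
    using S by (meson open_contains_ball)
  define d where "d = min d1 d2"
  have d: "d > 0" using d1 d2 by (simp add: d_def)
  have lin: "linear (D2 f x h)" using dG has_derivative_linear by blast
  have key: "dist ((f (x + t *\<^sub>R h + t *\<^sub>R k) - f (x + t *\<^sub>R h) - f (x + t *\<^sub>R k) + f x) / t\<^sup>2) (D2 f x h k) < e"
    if t: "0 < t" "t < d / (N + 1)" for t
  proof -
    have tN: "t * N < d"
      using t N by (simp add: field_simps) 
    define \<phi> where "\<phi> = (\<lambda>s::real. f (x + (s * t) *\<^sub>R h + t *\<^sub>R k) - f (x + (s * t) *\<^sub>R h))"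
    have nb: "norm ((s * t) *\<^sub>R h + r *\<^sub>R k) \<le> t * N" if "0 \<le> s" "s \<le> 1" "r = t \<or> r = 0" for s r
    proof -
      have "norm ((s * t) *\<^sub>R h + r *\<^sub>R k) \<le> norm ((s * t) *\<^sub>R h) + norm (r *\<^sub>R k)" by (rule norm_triangle_ineq)
      also have "\<dots> \<le> t * norm h + t * norm k"
        using that t by (intro add_mono) (auto simp: mult_right_mono mult_le_cancel_right1)
      finally show ?thesis by (simp add: N_def algebra_simps)
    qed
    have nb0: "norm ((s * t) *\<^sub>R h) \<le> t * N" if "0 \<le> s" "s \<le> 1" for s
      using nb[of s 0] that by simp
    have inS: "x + v \<in> S" if "norm v \<le> t * N" for v
      using that tN d2(2) by (auto simp: d_def dist_norm subset_iff)
    have der: "(\<phi> has_derivative (\<lambda>r. r * (t * (D1 f (x + (s * t) *\<^sub>R h + t *\<^sub>R k) h - D1 f (x + (s * t) *\<^sub>R h) h)))) (at s)"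
      if "0 \<le> s" "s \<le> 1" for s
    proof -
      have 1: "(f has_derivative D1 f (x + (s * t) *\<^sub>R h + t *\<^sub>R k)) (at (x + (s * t) *\<^sub>R h + t *\<^sub>R k))"
        using inS[OF nb[of s t]] that by (intro D1_works f) (auto simp: add.assoc)
      have 2: "(f has_derivative D1 f (x + (s * t) *\<^sub>R h)) (at (x + (s * t) *\<^sub>R h))"
        using inS[OF nb0[of s]] that by (intro D1_works f) auto
      have l1: "linear (D1 f (x + (s * t) *\<^sub>R h + t *\<^sub>R k))" "linear (D1 f (x + (s * t) *\<^sub>R h))"
        using 1 2 has_derivative_linear by blast+
      have a1: "((\<lambda>s. x + (s * t) *\<^sub>R h + t *\<^sub>R k) has_derivative (\<lambda>r. (r * t) *\<^sub>R h)) (at s)"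
        and a2: "((\<lambda>s. x + (s * t) *\<^sub>R h) has_derivative (\<lambda>r. (r * t) *\<^sub>R h)) (at s)"
        by (auto intro!: derivative_eq_intros)
      show ?thesis unfolding \<phi>_def
        using has_derivative_diff[OF has_derivative_compose[OF a1 1] has_derivative_compose[OF a2 2]]
        by (simp only: linear_cmul[OF l1(1)] linear_cmul[OF l1(2)] real_scaleR_def mult.assoc right_diff_distrib)
    qed
    obtain s where s: "0 < s" "s < 1"
      "\<phi> 1 - \<phi> 0 = t * (D1 f (x + (s * t) *\<^sub>R h + t *\<^sub>R k) h - D1 f (x + (s * t) *\<^sub>R h) h)"
    proof -
      have "\<exists>z. 0 < z \<and> z < 1 \<and> \<phi> 1 - \<phi> 0 = (1 - 0) * (t * (D1 f (x + (z * t) *\<^sub>R h + t *\<^sub>R k) h - D1 f (x + (z * t) *\<^sub>R h) h))"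
        by (intro MVT2 has_derivative_imp_has_field_derivative[OF der]) auto
      then show ?thesis using that by auto
    qed
    let ?a = "(s * t) *\<^sub>R h + t *\<^sub>R k" and ?b = "(s * t) *\<^sub>R h"
    have A: "\<bar>D1 f (x + ?a) h - D1 f x h - D2 f x h ?a\<bar> \<le> \<epsilon> * (t * N)"
      using d1(2)[of "x + ?a"] nb[of s t] s tN \<epsilon> 
      by (smt (verit) add_diff_cancel_left' d_def mult_left_mono real_norm_def)
    have B: "\<bar>D1 f (x + ?b) h - D1 f x h - D2 f x h ?b\<bar> \<le> \<epsilon> * (t * N)"
      using d1(2)[of "x + ?b"] nb0[of s] s tN \<epsilon> 
      by (smt (verit) add_diff_cancel_left' d_def mult_left_mono real_norm_def)
    have C: "D2 f x h ?a - D2 f x h ?b = t * D2 f x h k"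
      by (simp add: linear_add[OF lin] linear_cmul[OF lin])
    have "\<bar>(D1 f (x + ?a) h - D1 f (x + ?b) h) - t * D2 f x h k\<bar> \<le> 2 * (\<epsilon> * (t * N))"
      using A B C by linarith
    then have "t * \<bar>(D1 f (x + ?a) h - D1 f (x + ?b) h) - t * D2 f x h k\<bar> \<le> t * (2 * (\<epsilon> * (t * N)))"
      using t by (intro mult_left_mono) auto
    moreover have "(\<phi> 1 - \<phi> 0) - t\<^sup>2 * D2 f x h k =
        t * ((D1 f (x + ?a) h - D1 f (x + ?b) h) - t * D2 f x h k)"
      unfolding s(3) by (simp only: power2_eq_square right_diff_distrib mult.assoc add.assoc)
    ultimately have "\<bar>(\<phi> 1 - \<phi> 0) - t\<^sup>2 * D2 f x h k\<bar> \<le> (2 * \<epsilon> * N) * t\<^sup>2"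
      using t by (simp add: abs_mult power2_eq_square mult_ac)
    then have "\<bar>(\<phi> 1 - \<phi> 0) / t\<^sup>2 - D2 f x h k\<bar> \<le> 2 * \<epsilon> * N"
      using t by (simp add: field_simps abs_le_iff)
    then show ?thesis
      using \<epsilon> by (simp add: dist_real_def \<phi>_def algebra_simps)
  qed
  show "\<forall>\<^sub>F t in at_right 0. dist ((f (x + t *\<^sub>R h + t *\<^sub>R k) - f (x + t *\<^sub>R h) - f (x + t *\<^sub>R k) + f x) / t\<^sup>2) (D2 f x h k) < e"
    unfolding eventually_at_right_field
    using key d N by (intro exI[of _ "d / (N + 1)"]) auto
qed

lemma D2_symmetric:
  fixes f :: "'a::real_normed_vector \<Rightarrow> real"
  assumes S: "open S" "x \<in> S" and f: "\<And>y. y \<in> S \<Longrightarrow> f differentiable (at y)"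
    and G: "\<And>h. (\<lambda>y. D1 f y h) differentiable (at x)"
  shows "D2 f x h k = D2 f x k h"
proof -
  have "((\<lambda>t. (f (x + t *\<^sub>R h + t *\<^sub>R k) - f (x + t *\<^sub>R h) - f (x + t *\<^sub>R k) + f x) / t\<^sup>2)
           \<longlongrightarrow> D2 f x k h) (at_right 0)"
    using second_difference_tendsto[OF S f G, of k h] by (simp add: algebra_simps)
  with second_difference_tendsto[OF S f G, of h k] show ?thesis
    by (intro tendsto_unique[OF trivial_limit_at_right_real])
qed

lemma D1_cong_open:
  assumes "open S" "x \<in> S" "\<And>y. y \<in> S \<Longrightarrow> f y = g y" and "f differentiable (at x)"
  shows "D1 f x = D1 g x"
  using has_derivative_transform_within_open[OF D1_works[OF assms(4)] assms(1,2,3)] by (simp add: D1_unique)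

lemma linear_D1: "f differentiable (at x) \<Longrightarrow> linear (D1 f x)"
  using D1_works has_derivative_linear by blast

text \<open>Differentiating a homogeneity relation at a fixed factor \<open>t\<close>; with \<open>D1_radial\<close>, which differentiates
in \<open>t\<close>, this gives Euler's identities for \<open>F\<close> and for its first two derivatives.\<close>

lemma D1_scale:
  assumes S: "open S" "x \<in> S" and t: "t > 0" and f: "f differentiable (at x)" "f differentiable (at (t *\<^sub>R x))"
    and eq: "\<And>y. y \<in> S \<Longrightarrow> f (t *\<^sub>R y) = r * f y + s"
  shows "D1 f (t *\<^sub>R x) h = r / t * D1 f x h"
proof -
  have "((\<lambda>y. t *\<^sub>R y) has_derivative (\<lambda>h. t *\<^sub>R h)) (at x)" by (auto intro!: derivative_eq_intros)
  from has_derivative_compose[OF this D1_works[OF f(2)]]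
  have "((\<lambda>y. r * f y + s) has_derivative (\<lambda>h. D1 f (t *\<^sub>R x) (t *\<^sub>R h))) (at x)"
    by (rule has_derivative_transform_within_open[OF _ S]) (simp add: eq)
  moreover have "((\<lambda>y. r * f y + s) has_derivative (\<lambda>h. r * D1 f x h)) (at x)"
    by (auto intro!: derivative_eq_intros D1_works f)
  ultimately have "D1 f (t *\<^sub>R x) (t *\<^sub>R h) = r * D1 f x h"
    using has_derivative_unique by metis
  then show ?thesis using t by (simp add: linear_cmul[OF linear_D1[OF f(2)]] field_simps)
qed

lemma D1_radial:
  assumes f: "f differentiable (at x)" and d: "(\<phi> has_real_derivative d) (at 1)"
    and eq: "\<And>t. t > 0 \<Longrightarrow> f (t *\<^sub>R x) = \<phi> t"
  shows "D1 f x x = d"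
proof -
  have "((\<lambda>t. t *\<^sub>R x) has_derivative (\<lambda>r. r *\<^sub>R x)) (at (1::real))" by (auto intro!: derivative_eq_intros)
  moreover have "(f has_derivative D1 f x) (at (1 *\<^sub>R x))" using D1_works[OF f] by simp
  ultimately have "((\<lambda>t. f (t *\<^sub>R x)) has_derivative (\<lambda>r. D1 f x (r *\<^sub>R x))) (at (1::real))"
    by (rule has_derivative_compose)
  then have "(\<phi> has_derivative (\<lambda>r. D1 f x (r *\<^sub>R x))) (at 1)"
    by (rule has_derivative_transform_within_open[of _ _ _ _ "{0<..}"]) (auto simp: eq)
  moreover have "(\<phi> has_derivative (\<lambda>r. d * r)) (at 1)"
    using d by (simp add: has_field_derivative_def)
  ultimately have "D1 f x (1 *\<^sub>R x) = d * 1"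
    using has_derivative_unique by metis
  then show ?thesis by simp
qed

section \<open>Fields of operators\<close>

text \<open>The product rule for an operator field that is only known to be differentiable at each fixed vector;
expanding the argument in the basis reduces it to finitely many such vectors.\<close>

lemma has_derivative_operator_apply:
  fixes A :: "'c::real_normed_vector \<Rightarrow> 'a::euclidean_space \<Rightarrow> 'b::real_normed_vector"
  assumes S: "open S" "x \<in> S" and lin: "\<And>y. y \<in> S \<Longrightarrow> linear (A y)"
    and A: "\<And>k. ((\<lambda>y. A y k) has_derivative (\<lambda>h. A' h k)) (at x)"
    and u: "(u has_derivative u') (at x)"
  shows "((\<lambda>y. A y (u y)) has_derivative (\<lambda>h. A' h (u x) + A x (u' h))) (at x)"
proof -
  have expand: "A y v = (\<Sum>b\<in>Basis. (v \<bullet> b) *\<^sub>R A y b)" if "y \<in> S" for y v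
  proof -
    have "A y v = A y (\<Sum>b\<in>Basis. (v \<bullet> b) *\<^sub>R b)" by (simp add: euclidean_representation)
    then show ?thesis
      by (simp add: linear_sum[OF lin[OF that]] linear_cmul[OF lin[OF that]])
  qed
  have A'lin: "A' h v = (\<Sum>b\<in>Basis. (v \<bullet> b) *\<^sub>R A' h b)" for h v
  proof -
    have "((\<lambda>y. \<Sum>b\<in>Basis. (v \<bullet> b) *\<^sub>R A y b) has_derivative (\<lambda>h. \<Sum>b\<in>Basis. (v \<bullet> b) *\<^sub>R A' h b)) (at x)"
      by (intro derivative_intros A)
    then have "((\<lambda>y. A y v) has_derivative (\<lambda>h. \<Sum>b\<in>Basis. (v \<bullet> b) *\<^sub>R A' h b)) (at x)"
      by (rule has_derivative_transform_within_open[OF _ S]) (simp add: expand)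
    from has_derivative_unique[OF this A[of v]] show ?thesis by metis
  qed
  have "((\<lambda>y. \<Sum>b\<in>Basis. (u y \<bullet> b) *\<^sub>R A y b) has_derivative
         (\<lambda>h. \<Sum>b\<in>Basis. (u x \<bullet> b) *\<^sub>R A' h b + (u' h \<bullet> b) *\<^sub>R A x b)) (at x)"
    by (intro derivative_intros A u)
  then have "((\<lambda>y. A y (u y)) has_derivative
         (\<lambda>h. \<Sum>b\<in>Basis. (u x \<bullet> b) *\<^sub>R A' h b + (u' h \<bullet> b) *\<^sub>R A x b)) (at x)"
    by (rule has_derivative_transform_within_open[OF _ S]) (simp add: expand)
  moreover have "(\<lambda>h. \<Sum>b\<in>Basis. (u x \<bullet> b) *\<^sub>R A' h b + (u' h \<bullet> b) *\<^sub>R A x b) =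
      (\<lambda>h. A' h (u x) + A x (u' h))"
    by (rule ext, subst A'lin, subst (2) expand[OF S(2)], rule sum.distrib)
  ultimately show ?thesis by simp
qed

text \<open>The equations say that \<open>T = H\<^sup>-\<^sup>1 M\<close> satisfies \<open>M' = H' T\<close>, so that formally
\<open>T' = H\<^sup>-\<^sup>1 (M' - H' T) = 0\<close>. Near \<open>x\<close> one has \<open>T y k - T x k = (H y)\<^sup>-\<^sup>1 (M y k - H y (T x k))\<close>, where
the bracket is of order \<open>o(y - x)\<close> and \<open>H y\<close> is bounded below uniformly, so no derivative of an
inverse is needed.\<close>

lemma operator_quotient_constant:
  fixes H M T :: "'a::euclidean_space \<Rightarrow> 'a \<Rightarrow> 'a"
  assumes S: "open S" "convex S"
    and lin: "\<And>y. y \<in> S \<Longrightarrow> linear (H y)" and inj: "\<And>y. y \<in> S \<Longrightarrow> inj (H y)"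
    and H: "\<And>y k. y \<in> S \<Longrightarrow> ((\<lambda>y. H y k) has_derivative (\<lambda>h. H' y h k)) (at y)"
    and M: "\<And>y k. y \<in> S \<Longrightarrow> ((\<lambda>y. M y k) has_derivative (\<lambda>h. M' y h k)) (at y)"
    and T: "\<And>y k. y \<in> S \<Longrightarrow> H y (T y k) = M y k"
    and M': "\<And>y h k. y \<in> S \<Longrightarrow> M' y h k = H' y h (T y k)"
    and xy: "x \<in> S" "y \<in> S"
  shows "T x k = T y k"
proof (rule has_derivative_zero_unique[OF S(2) _ xy])
  fix x assume x: "x \<in> S"
  define N where "N = (\<lambda>y. M y k - H y (T x k))"
  have "(N has_derivative (\<lambda>h. M' x h k - H' x h (T x k))) (at x)"
    unfolding N_def by (intro derivative_intros H M x)
  then have N: "(N has_derivative (\<lambda>h. 0)) (at x)"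
    by (simp add: M'[OF x])
  have N0: "N x = 0" using x by (simp add: N_def T)
  obtain c where c: "c > 0" "\<And>u. c * norm u \<le> norm (H x u)"
    using linear_inj_bounded_below_pos[OF lin[OF x] inj[OF x]] by blast
  have "((\<lambda>y. \<Sum>b\<in>Basis. norm (H y b - H x b)) \<longlongrightarrow> (\<Sum>b\<in>Basis. norm (H x b - H x b))) (at x)"
    using has_derivative_continuous[OF H[OF x]]
    by (intro tendsto_intros) (simp add: continuous_at)
  then have "\<forall>\<^sub>F y in at x. (\<Sum>b\<in>Basis. norm (H y b - H x b)) < c / 2"
    using c(1) by (intro order_tendstoD(2)[where a = "c/2"]) auto
  moreover have "\<forall>\<^sub>F y in at x. y \<in> S"
    using S(1) x by (rule eventually_at_in_open')
  ultimately have ev: "\<forall>\<^sub>F y in at x. norm (T y k - T x k) \<le> (2 / c) * norm (N y)"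
  proof eventually_elim
    case (elim y)
    define u where "u = T y k - T x k"
    have "norm (H y u - H x u) \<le> norm u * (\<Sum>b\<in>Basis. norm (H y b - H x b))"
    proof -
      have "linear (\<lambda>u. H y u - H x u)"
        using lin elim x by (intro linear_compose_sub) auto
      then have "H y u - H x u = (\<Sum>b\<in>Basis. (u \<bullet> b) *\<^sub>R (H y b - H x b))"
        using linear_sum[of "\<lambda>u. H y u - H x u" "\<lambda>b. (u \<bullet> b) *\<^sub>R b" Basis]
          linear_cmul[of "\<lambda>u. H y u - H x u"] by (simp add: euclidean_representation)
      then have "norm (H y u - H x u) \<le> (\<Sum>b\<in>Basis. norm ((u \<bullet> b) *\<^sub>R (H y b - H x b)))"
        by (simp only: norm_sum)
      also have "\<dots> \<le> (\<Sum>b\<in>Basis. norm u * norm (H y b - H x b))"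
        by (intro sum_mono) (auto intro!: mult_right_mono simp: Basis_le_norm)
      finally show ?thesis by (simp add: sum_distrib_left)
    qed
    also have "\<dots> \<le> norm u * (c / 2)"
      using elim by (intro mult_left_mono) auto
    finally have "norm (H x u) - norm u * (c / 2) \<le> norm (H y u)"
      by (smt (verit) norm_minus_commute norm_triangle_ineq2)
    then have "c / 2 * norm u \<le> norm (H y u)"
      using c(2)[of u] by (simp add: algebra_simps)
    moreover have "H y u = N y"
      using elim x by (simp add: u_def N_def linear_diff[OF lin] T)
    ultimately show ?case
      using c(1) by (simp add: u_def field_simps)
  qed
  have lim: "((\<lambda>y. norm (N y - N x) / norm (y - x)) \<longlongrightarrow> 0) (at x)"
    using N by (simp add: has_derivative_iff_norm)
  have "((\<lambda>y. (2 / c) * (norm (N y - N x) / norm (y - x))) \<longlongrightarrow> 0) (at x)"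
    by (rule tendsto_mult_right_zero[OF lim])
  then have "((\<lambda>y. norm (T y k - T x k) / norm (y - x)) \<longlongrightarrow> 0) (at x)"
  proof (rule tendsto_sandwich[OF _ _ tendsto_const, rotated -1])
    show "\<forall>\<^sub>F y in at x. norm (T y k - T x k) / norm (y - x) \<le> (2 / c) * (norm (N y - N x) / norm (y - x))"
      using ev
    proof eventually_elim
      case (elim y)
      from divide_right_mono[OF this, of "norm (y - x)"] show ?case by (simp add: N0)
    qed
  qed auto
  then have "((\<lambda>y. T y k) has_derivative (\<lambda>h. 0)) (at x)"
    by (simp add: has_derivative_iff_norm)
  then show "((\<lambda>y. T y k) has_derivative (\<lambda>h. 0)) (at x within S)"
    by (rule has_derivative_at_withinI)
qed

text \<open>The rigidity step. Think of \<open>H\<close> and \<open>M\<close> as the Hessian fields of two functions, the first of them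
logarithmically homogeneous, and let \<open>c h k l = \<langle>H' h k, l\<rangle>\<close> be the symmetric third derivative of the
first. For \<open>Q w = (H x)\<^sup>-\<^sup>1 (H w)\<close> the equivariance of \<open>M\<close> reads \<open>\<langle>M (Q w x) (Q w k), Q w l\<rangle> = \<langle>M x k, l\<rangle>\<close>;
its derivative in \<open>w\<close> at \<open>x\<close> is
\<open>2 \<langle>M' h k, l\<rangle> = c h k (T l) + c h l (T k)\<close> with \<open>T = (H x)\<^sup>-\<^sup>1 (M x)\<close>.
Exchanging \<open>h\<close> and \<open>k\<close> shows that \<open>c h l (T k)\<close> is symmetric in \<open>h\<close> and \<open>k\<close>; thus \<open>T\<close> may be moved freely
among the arguments of \<open>c\<close>, and the formula becomes \<open>M' h k = H' h (T k)\<close>.\<close>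

lemma hessian_quotient_constant:
  fixes H M :: "'a::euclidean_space \<Rightarrow> 'a \<Rightarrow> 'a"
  assumes S: "open S" "convex S" "S \<noteq> {}"
    and Hlin: "\<And>y. y \<in> S \<Longrightarrow> linear (H y)" and Hbij: "\<And>y. y \<in> S \<Longrightarrow> bij (H y)"
    and Hsym: "\<And>y u v. y \<in> S \<Longrightarrow> H y u \<bullet> v = u \<bullet> H y v"
    and Mlin: "\<And>y. y \<in> S \<Longrightarrow> linear (M y)"
    and Msym: "\<And>y u v. y \<in> S \<Longrightarrow> M y u \<bullet> v = u \<bullet> M y v"
    and dH: "\<And>y k. y \<in> S \<Longrightarrow> ((\<lambda>y. H y k) has_derivative (\<lambda>h. H' y h k)) (at y)"
    and dM: "\<And>y k. y \<in> S \<Longrightarrow> ((\<lambda>y. M y k) has_derivative (\<lambda>h. M' y h k)) (at y)"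
    and H'swap: "\<And>y h k. y \<in> S \<Longrightarrow> H' y h k = H' y k h"
    and H'sym: "\<And>y h k l. y \<in> S \<Longrightarrow> H' y h k \<bullet> l = k \<bullet> H' y h l"
    and M'swap: "\<And>y h k. y \<in> S \<Longrightarrow> M' y h k = M' y k h"
    and H'self: "\<And>y h. y \<in> S \<Longrightarrow> H' y h y = - 2 *\<^sub>R H y h"
    and eqv: "\<And>x w z Q. x \<in> S \<Longrightarrow> w \<in> S \<Longrightarrow> z \<in> S \<Longrightarrow> linear Q \<Longrightarrow> (\<And>k. H x (Q k) = H w k) \<Longrightarrow>
       Q z \<in> S \<and> (\<forall>k l. M (Q z) (Q k) \<bullet> Q l = M z k \<bullet> l)"
  shows "\<exists>T. linear T \<and> (\<forall>x\<in>S. \<forall>k. M x k = H x (T k))"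
proof -
  define G where "G = (\<lambda>x. inv (H x))"
  have HG: "H x (G x v) = v" and GH: "G x (H x v) = v" if "x \<in> S" for x v
    using Hbij[OF that] by (auto simp: G_def bij_is_surj surj_f_inv_f bij_is_inj)
  have Glin: "linear (G x)" if "x \<in> S" for x
    using Hlin[OF that] bij_is_inj[OF Hbij[OF that]] unfolding G_def by (rule inj_linear_imp_inv_linear)
  have Gsym: "G x u \<bullet> v = u \<bullet> G x v" if "x \<in> S" for x u v
    by (metis HG Hsym that)
  define T where "T = (\<lambda>x k. G x (M x k))"
  have key: "M' x h k = H' x h (T x k)" if x: "x \<in> S" for x h k
  proof -
    define Q where "Q = (\<lambda>w k. G x (H w k))"
    have Qx: "Q x k = k" for k by (simp add: Q_def GH x)
    have Qlin: "linear (Q w)" if "w \<in> S" for w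
      using linear_compose[OF Hlin[OF that] Glin[OF x]] by (simp add: Q_def[abs_def] o_def)
    have dQ: "((\<lambda>w. Q w k) has_derivative (\<lambda>h. G x (H' x h k))) (at x)" for k
      unfolding Q_def
      by (rule bounded_linear.has_derivative[OF linear_conv_bounded_linear[THEN iffD1, OF Glin[OF x]] dH[OF x]])
    have QS: "Q w z \<in> S" and QM: "M (Q w z) (Q w k) \<bullet> Q w l = M z k \<bullet> l" if "w \<in> S" "z \<in> S" for w z k l
      using eqv[OF x that Qlin[OF that(1)]] by (auto simp: Q_def HG x)
    have M'lin: "linear (\<lambda>h. M' x h k)" for k
      using dM[OF x, of k] has_derivative_linear by blast
    have dA: "((\<lambda>w. M (Q w x) k) has_derivative (\<lambda>h. - 2 *\<^sub>R M' x h k)) (at x)" for k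
    proof -
      have "((\<lambda>w. Q w x) has_derivative (\<lambda>h. - 2 *\<^sub>R h)) (at x)"
        using dQ[of x] by (simp add: H'self[OF x] linear_cmul[OF Glin[OF x]] linear_neg[OF Glin[OF x]] GH[OF x])
      then have "((\<lambda>w. M (Q w x) k) has_derivative (\<lambda>h. M' x (- 2 *\<^sub>R h) k)) (at x)"
        by (rule has_derivative_compose) (simp add: Qx dM[OF x])
      then show ?thesis by (simp only: linear_cmul[OF M'lin])
    qed
    have dB: "((\<lambda>w. M (Q w x) (Q w k)) has_derivative
        (\<lambda>h. - 2 *\<^sub>R M' x h k + M x (G x (H' x h k)))) (at x)" for k
      using has_derivative_operator_apply[where A = "\<lambda>w. M (Q w x)" and A' = "\<lambda>h k. - 2 *\<^sub>R M' x h k",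
          OF S(1) x Mlin[OF QS[OF _ x]] dA dQ[of k]] by (simp add: Qx)
    have dC: "((\<lambda>w. M (Q w x) (Q w k) \<bullet> Q w l) has_derivative
        (\<lambda>h. M x k \<bullet> G x (H' x h l) + (- 2 *\<^sub>R M' x h k + M x (G x (H' x h k))) \<bullet> l)) (at x)" for k l
      using has_derivative_inner[OF dB[of k] dQ[of l]] by (simp add: Qx)
    \<comment> \<open>by equivariance the function differentiated in \<open>dC\<close> is constant near \<open>x\<close>\<close>
    have eq0: "M x k \<bullet> G x (H' x h l) + (- 2 *\<^sub>R M' x h k + M x (G x (H' x h k))) \<bullet> l = 0" for h k l
    proof -
      have "((\<lambda>w. M x k \<bullet> l) has_derivative (\<lambda>h. 0)) (at x)" by simp
      then have "((\<lambda>w. M (Q w x) (Q w k) \<bullet> Q w l) has_derivative (\<lambda>h. 0)) (at x)"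
        by (rule has_derivative_transform_within_open[OF _ S(1) x]) (simp add: QM x)
      from has_derivative_unique[OF dC this] show ?thesis by metis
    qed
    define c where "c = (\<lambda>h k l. H' x h k \<bullet> l)"
    have c1: "c h k l = c k h l" and c2: "c h k l = c h l k" for h k l
      using H'swap[OF x, of h k] H'sym[OF x, of h k l] by (simp_all add: c_def inner_commute[of k])
    have M'c: "2 * (M' x h k \<bullet> l) = c h k (T x l) + c h l (T x k)" for h k l
    proof -
      have "M x k \<bullet> G x (H' x h l) = c h l (T x k)"
        unfolding c_def T_def by (metis Gsym[OF x] inner_commute)
      moreover have "M x (G x (H' x h k)) \<bullet> l = c h k (T x l)"
        unfolding c_def T_def Msym[OF x] Gsym[OF x] ..
      ultimately show ?thesis using eq0[of k h l] by (simp add: inner_add_left inner_diff_left)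
    qed
    have c3: "c l h (T x k) = c l k (T x h)" for h k l
    proof -
      have "c h l (T x k) = c k l (T x h)"
        using M'c[of h k l] M'c[of k h l] M'swap[OF x, of h k] c1[of h k "T x l"] by simp
      then show ?thesis by (simp add: c1[of l])
    qed
    have "M' x h k \<bullet> l = H' x h (T x k) \<bullet> l" for l
      using M'c[of h k l] c3[of h k l] c2[of h l "T x k"] by (simp add: c_def)
    then show ?thesis by (metis vector_eq_rdot)
  qed
  obtain e where e: "e \<in> S" using S(3) by blast
  have "M x k = H x (T e k)" if x: "x \<in> S" for x k
  proof -
    have "T x k = T e k"
      by (rule operator_quotient_constant[where T = T and k = k, OF S(1,2) Hlin bij_is_inj[OF Hbij] dH dM _ key x e])
         (simp_all add: T_def HG)
    then show ?thesis using HG[OF x, of "M x k"] by (simp add: T_def)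
  qed
  moreover have "linear (T e)"
    using linear_compose[OF Mlin[OF e] Glin[OF e]] by (simp add: T_def o_def)
  ultimately show ?thesis by blast
qed

section \<open>Laplace transforms over the dual cone\<close>

text \<open>Comparison with a step function on the balls of radius \<open>k + 1\<close>, whose volumes grow polynomially
in \<open>k\<close>.\<close>

lemma integrable_exp_neg_norm:
  assumes c: "c > 0"
  shows "integrable lborel (\<lambda>y::'a::euclidean_space. exp (- (c * norm y)))"
proof -
  define n where "n = DIM('a)"
  define V where "V = measure lborel (cball (0::'a) 1)"
  define g where "g = (\<lambda>(k::nat) (y::'a). indicator (cball 0 (real k + 1)) y *\<^sub>R exp (- (c * real k)))"
  have g0: "g k y \<ge> 0" "g k y \<le> exp (- c) ^ k" for k y
    by (auto simp: g_def indicator_def exp_of_nat_mult[symmetric] mult.commute)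
  have gi: "integrable lborel (g k)" for k
    unfolding g_def by (intro integrable_scaleR_left integrable_real_indicator)
      (auto simp: emeasure_cball)
  have vol: "measure lborel (cball (0::'a) (real k + 1)) = V * (real k + 1) ^ n" for k
    by (simp add: V_def n_def content_cball)
  have gint: "(\<integral>y. norm (g k y) \<partial>lborel) = V * ((real k + 1) ^ n * exp (- (c * real k)))" for k
  proof -
    have "(\<integral>y. norm (g k y) \<partial>lborel) = (\<integral>y. g k y \<partial>lborel)"
      using g0 by simp
    also have "\<dots> = measure lborel (cball (0::'a) (real k + 1)) * exp (- (c * real k))"
      unfolding g_def by (subst integral_scaleR_left) (auto simp: emeasure_cball)
    finally show ?thesis by (simp add: vol)
  qed
  \<comment> \<open>\<open>\<delta> n \<le> c / 2\<close> leaves half of the exponential decay after absorbing the polynomial\<close>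
  define \<delta> where "\<delta> = min 1 (c / (2 * (real n + 1)))"
  have \<delta>: "0 < \<delta>" "\<delta> \<le> 1" "\<delta> * real n \<le> c / 2"
  proof -
    show "0 < \<delta>" "\<delta> \<le> 1" using c by (auto simp: \<delta>_def)
    have "\<delta> * real n \<le> (c / (2 * (real n + 1))) * real n"
      by (intro mult_right_mono) (auto simp: \<delta>_def)
    also have "\<dots> \<le> c / 2" using c by (simp add: field_simps)
    finally show "\<delta> * real n \<le> c / 2" .
  qed
  have poly: "(real k + 1) ^ n * exp (- (c * real k)) \<le> (1 / \<delta>) ^ n * exp (- (c / 2)) ^ k" for k
  proof -
    have "\<delta> * (real k + 1) \<le> 1 + \<delta> * real k" using \<delta> by (simp add: algebra_simps)
    also have "\<dots> \<le> exp (\<delta> * real k)" by (rule exp_ge_add_one_self)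
    finally have "real k + 1 \<le> (1 / \<delta>) * exp (\<delta> * real k)" using \<delta> by (simp add: field_simps)
    then have "(real k + 1) ^ n \<le> ((1 / \<delta>) * exp (\<delta> * real k)) ^ n"
      by (intro power_mono) auto
    also have "\<dots> = (1 / \<delta>) ^ n * exp (real n * (\<delta> * real k))"
      by (simp only: power_mult_distrib exp_of_nat_mult)
    also have "\<dots> \<le> (1 / \<delta>) ^ n * exp (c / 2 * real k)"
      using \<delta> mult_right_mono[OF \<delta>(3), of "real k"] by (intro mult_left_mono) (auto simp: mult_ac)
    finally have "(real k + 1) ^ n * exp (- (c * real k)) \<le> (1 / \<delta>) ^ n * exp (c / 2 * real k) * exp (- (c * real k))"
      by (intro mult_right_mono) auto
    also have "\<dots> = (1 / \<delta>) ^ n * exp (- (c / 2)) ^ k"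
      by (simp add: mult.assoc exp_add[symmetric] exp_of_nat_mult[symmetric] field_simps)
    finally show ?thesis .
  qed
  have sum1: "summable (\<lambda>k. V * ((real k + 1) ^ n * exp (- (c * real k))))"
  proof (rule summable_mult, rule summable_comparison_test')
    show "summable (\<lambda>k. (1 / \<delta>) ^ n * exp (- (c / 2)) ^ k)"
      using c by (intro summable_mult summable_geometric) auto
    show "norm ((real k + 1) ^ n * exp (- (c * real k))) \<le> (1 / \<delta>) ^ n * exp (- (c / 2)) ^ k" for k
      using poly[of k] by (simp add: abs_mult)
  qed
  have sumg: "summable (\<lambda>k. norm (g k y))" for y
    using g0 c by (intro summable_comparison_test'[OF summable_geometric[of "exp (- c)"]]) auto
  have int: "integrable lborel (\<lambda>y. \<Sum>k. g k y)"
    using sum1 by (intro integrable_suminf gi AE_I2 sumg) (simp only: gint)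
  show ?thesis
  proof (rule Bochner_Integration.integrable_bound[OF int])
    show "AE y in lborel. norm (exp (- (c * norm y))) \<le> norm (\<Sum>k. g k (y::'a))"
    proof (rule AE_I2)
      fix y :: 'a
      define k where "k = nat \<lfloor>norm y\<rfloor>"
      have "real k = of_int \<lfloor>norm y\<rfloor>" by (simp add: k_def)
      then have k: "real k \<le> norm y" "norm y \<le> real k + 1"
        by linarith+
      have "exp (- (c * norm y)) \<le> g k y"
        using k c by (simp add: g_def)
      also have "\<dots> \<le> (\<Sum>k. g k y)"
        using sum_le_suminf[of "\<lambda>k. g k y" "{k}"] sumg[of y] g0 by simp
      finally show "norm (exp (- (c * norm y))) \<le> norm (\<Sum>k. g k (y::'a))"
        by simp
    qed
  qed simp
qed

text \<open>A class of weights for which the Laplace integral over the dual cone converges at every interior point of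
the cone. The class contains the constants and linear functions and is closed under products, so a
Laplace transform may be differentiated repeatedly within it.\<close>

definition subexponential :: "('a::euclidean_space \<Rightarrow> 'b::euclidean_space) \<Rightarrow> bool" where
  "subexponential q \<longleftrightarrow> q \<in> borel_measurable borel \<and>
     (\<forall>\<epsilon>>0. \<exists>C. \<forall>y. norm (q y) \<le> C * exp (\<epsilon> * norm y))"

lemma norm_le_exp_norm:
  assumes "\<epsilon> > 0" shows "norm y \<le> (1 / \<epsilon>) * exp (\<epsilon> * norm y)"
proof -
  have "\<epsilon> * norm y \<le> exp (\<epsilon> * norm y)"
    using exp_ge_add_one_self[of "\<epsilon> * norm y"] by linarith
  then show ?thesis using assms by (simp add: field_simps)
qed

lemma subexponential_const: "subexponential (\<lambda>_. a)"
  unfolding subexponential_def by (auto intro!: exI[of _ "norm a"] simp: mult_le_cancel_left1)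

lemma subexponential_scale:
  assumes p: "subexponential p" and q: "subexponential q"
  shows "subexponential (\<lambda>y. p y *\<^sub>R q y)"
  unfolding subexponential_def
proof (intro conjI allI impI)
  show "(\<lambda>y. p y *\<^sub>R q y) \<in> borel_measurable borel"
    using p q by (auto simp: subexponential_def)
  fix \<epsilon> :: real assume e: "\<epsilon> > 0"
  then have e2: "\<epsilon> / 2 > 0" by simp
  obtain C where C: "\<And>y. norm (p y) \<le> C * exp (\<epsilon> / 2 * norm y)"
    using p e2 unfolding subexponential_def by blast
  obtain D where D: "\<And>y. norm (q y) \<le> D * exp (\<epsilon> / 2 * norm y)"
    using q e2 unfolding subexponential_def by blast
  have "norm (p y *\<^sub>R q y) \<le> (C * D) * exp (\<epsilon> * norm y)" for y
  proof -
    have "norm (p y *\<^sub>R q y) \<le> (C * exp (\<epsilon> / 2 * norm y)) * (D * exp (\<epsilon> / 2 * norm y))"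
      using C[of y] D[of y] order_trans[OF norm_ge_zero C[of y]] by (auto simp: intro!: mult_mono)
    also have "\<dots> = (C * D) * exp (\<epsilon> / 2 * norm y + \<epsilon> / 2 * norm y)"
      by (simp only: exp_add mult_ac)
    finally show ?thesis by simp
  qed
  then show "\<exists>C. \<forall>y. norm (p y *\<^sub>R q y) \<le> C * exp (\<epsilon> * norm y)" by blast
qed

lemma subexponential_id: "subexponential (\<lambda>y. y)"
  unfolding subexponential_def using norm_le_exp_norm by (intro conjI) (simp, blast)

lemma subexponential_inner: "subexponential (\<lambda>y. h \<bullet> y)"
  unfolding subexponential_def
proof (intro conjI allI impI)
  fix \<epsilon> :: real assume e: "\<epsilon> > 0"
  have "norm (h \<bullet> y) \<le> (norm h / \<epsilon>) * exp (\<epsilon> * norm y)" for y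
    using mult_left_mono[OF norm_le_exp_norm[OF e, of y], of "norm h"] Cauchy_Schwarz_ineq2[of h y]
    by simp
  then show "\<exists>C. \<forall>y. norm (h \<bullet> y) \<le> C * exp (\<epsilon> * norm y)" by blast
qed simp

lemma subexponential_norm_sq: "subexponential (\<lambda>y. (norm y)\<^sup>2)"
proof -
  have "subexponential (\<lambda>y::'a. norm y)"
    unfolding subexponential_def real_norm_def abs_norm_cancel
    using norm_le_exp_norm by (intro conjI) (simp, blast)
  from subexponential_scale[OF this this] show ?thesis by (simp add: power2_eq_square)
qed

definition laplace :: "'a::euclidean_space set \<Rightarrow> ('a \<Rightarrow> 'b::euclidean_space) \<Rightarrow> 'a \<Rightarrow> 'b" where
  "laplace L q x = (LINT y:L|lborel. exp (- (x \<bullet> y)) *\<^sub>R q y)"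

lemma laplace_integrable:
  assumes L: "L \<in> sets borel" and c: "c > 0" "\<And>y. y \<in> L \<Longrightarrow> c * norm y \<le> x \<bullet> y"
    and q: "subexponential q"
  shows "set_integrable lborel L (\<lambda>y. exp (- (x \<bullet> y)) *\<^sub>R q y)"
proof -
  have [measurable]: "q \<in> borel_measurable borel" using q by (simp add: subexponential_def)
  note [measurable] = L
  have "c / 2 > 0" using c by simp
  then obtain C where C: "\<And>y. norm (q y) \<le> C * exp (c / 2 * norm y)"
    using q unfolding subexponential_def by blast
  have C0: "C \<ge> 0" using order_trans[OF norm_ge_zero C[of 0]] by simp
  show ?thesis unfolding set_integrable_def
  proof (rule Bochner_Integration.integrable_bound)
    show "integrable lborel (\<lambda>y::'a. C * exp (- (c / 2 * norm y)))"
      using integrable_exp_neg_norm[of "c / 2"] c by (intro integrable_mult_right) auto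
    show "(\<lambda>y. indicat_real L y *\<^sub>R exp (- (x \<bullet> y)) *\<^sub>R q y) \<in> borel_measurable lborel"
      by measurable
    show "AE y in lborel. norm (indicat_real L y *\<^sub>R exp (- (x \<bullet> y)) *\<^sub>R q y)
        \<le> norm (C * exp (- (c / 2 * norm y)))"
    proof (rule AE_I2)
      fix y
      have "exp (- (x \<bullet> y)) * norm (q y) \<le> C * exp (- (c / 2 * norm y))" if "y \<in> L"
      proof -
        have "exp (- (x \<bullet> y)) * norm (q y) \<le> exp (- (c * norm y)) * (C * exp (c / 2 * norm y))"
          using c(2)[OF that] C[of y] by (intro mult_mono) auto
        also have "\<dots> = C * exp (- (c * norm y) + c / 2 * norm y)" by (simp only: exp_add mult_ac)
        also have "- (c * norm y) + c / 2 * norm y = - (c / 2 * norm y)" by simp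
        finally show ?thesis .
      qed
      then show "norm (indicat_real L y *\<^sub>R exp (- (x \<bullet> y)) *\<^sub>R q y) \<le> norm (C * exp (- (c / 2 * norm y)))"
        using C0 by (auto simp: indicator_def abs_mult)
    qed
  qed
qed

lemma exp_remainder_bound: "\<bar>exp (- u) - 1 + u\<bar> \<le> u\<^sup>2 * exp \<bar>u\<bar>" for u :: real
proof -
  have *: "exp v - 1 - v \<le> v\<^sup>2 * exp \<bar>v\<bar>" for v :: real
  proof -
    have a: "exp v * (1 - v) \<le> 1"
    proof -
      have "exp v * (1 - v) \<le> exp v * exp (- v)"
        using exp_ge_add_one_self[of "- v"] by (intro mult_left_mono) auto
      then show ?thesis by (simp add: exp_minus)
    qed
    have b: "exp v - 1 - v \<le> v * (exp v - 1)" using a by (simp add: algebra_simps)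
    also have "\<dots> \<le> v\<^sup>2 * exp \<bar>v\<bar>"
    proof (cases "v \<ge> 0")
      case True
      have "exp v - 1 \<le> v * exp v" using a by (simp add: algebra_simps)
      from mult_left_mono[OF this True] show ?thesis using True by (simp add: power2_eq_square mult.assoc)
    next
      case False
      have "v * (exp v - 1) \<le> v * v"
        using False exp_ge_add_one_self[of v] by (intro mult_left_mono_neg) linarith+
      also have "\<dots> \<le> v\<^sup>2 * exp \<bar>v\<bar>"
        by (simp add: power2_eq_square mult_le_cancel_left1)
      finally show ?thesis .
    qed
    finally show ?thesis .
  qed
  have "exp (- u) - 1 + u \<ge> 0" using exp_ge_add_one_self[of "- u"] by linarith
  then show ?thesis using *[of "- u"] by simp
qed

text \<open>Differentiation under the integral sign. The pointwise remainder is bounded through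
\<open>exp_remainder_bound\<close> by \<open>\<parallel>h\<parallel>\<^sup>2\<close> times a function that is integrable uniformly in \<open>h\<close>: for
\<open>\<parallel>h\<parallel> < c / 2\<close>, half of the exponential decay \<open>c\<close> pays for \<open>exp \<bar>\<langle>h, y\<rangle>\<bar>\<close>, and a quarter pays for the
weight \<open>\<parallel>y\<parallel>\<^sup>2 q y\<close>.\<close>

lemma laplace_has_derivative:
  assumes L: "L \<in> sets borel" and c: "c > 0" "\<And>y. y \<in> L \<Longrightarrow> c * norm y \<le> x \<bullet> y"
    and q: "subexponential q"
  shows "(laplace L q has_derivative (\<lambda>h. - laplace L (\<lambda>y. (h \<bullet> y) *\<^sub>R q y) x)) (at x)"
proof -
  have [measurable]: "q \<in> borel_measurable borel" using q by (simp add: subexponential_def)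
  note [measurable] = L
  have int: "set_integrable lborel L (\<lambda>y. exp (- (x \<bullet> y)) *\<^sub>R (h \<bullet> y) *\<^sub>R q y)" for h
    using L c subexponential_scale[OF subexponential_inner q] by (rule laplace_integrable)
  have int0: "set_integrable lborel L (\<lambda>y. exp (- (x \<bullet> y)) *\<^sub>R q y)"
    using L c q by (rule laplace_integrable)
  have lin: "linear (\<lambda>h. laplace L (\<lambda>y. (h \<bullet> y) *\<^sub>R q y) x)"
  proof (rule linearI)
    fix h k r
    have "exp (- (x \<bullet> y)) *\<^sub>R ((h + k) \<bullet> y) *\<^sub>R q y =
       exp (- (x \<bullet> y)) *\<^sub>R (h \<bullet> y) *\<^sub>R q y + exp (- (x \<bullet> y)) *\<^sub>R (k \<bullet> y) *\<^sub>R q y" for y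
      by (simp add: inner_add_left algebra_simps)
    then show "laplace L (\<lambda>y. ((h + k) \<bullet> y) *\<^sub>R q y) x =
      laplace L (\<lambda>y. (h \<bullet> y) *\<^sub>R q y) x + laplace L (\<lambda>y. (k \<bullet> y) *\<^sub>R q y) x"
      using set_integral_add(2)[OF int[of h] int[of k]] by (simp add: laplace_def)
    have "exp (- (x \<bullet> y)) *\<^sub>R ((r *\<^sub>R h) \<bullet> y) *\<^sub>R q y = r *\<^sub>R (exp (- (x \<bullet> y)) *\<^sub>R (h \<bullet> y) *\<^sub>R q y)" for y
      by simp
    then show "laplace L (\<lambda>y. ((r *\<^sub>R h) \<bullet> y) *\<^sub>R q y) x = r *\<^sub>R laplace L (\<lambda>y. (h \<bullet> y) *\<^sub>R q y) x"
      unfolding laplace_def by (simp only: set_integral_scaleR_right)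
  qed
  have "c / 4 > 0" using c by simp
  moreover have "subexponential (\<lambda>y. (norm y)\<^sup>2 *\<^sub>R q y)"
    by (rule subexponential_scale[OF subexponential_norm_sq q])
  ultimately obtain C where C: "\<And>y. norm ((norm y)\<^sup>2 *\<^sub>R q y) \<le> C * exp (c / 4 * norm y)"
    unfolding subexponential_def by blast
  define B where "B = (\<integral>y. C * exp (- (c / 4 * norm (y::'a))) \<partial>lborel)"
  have intB: "integrable lborel (\<lambda>y::'a. C * exp (- (c / 4 * norm y)))"
    using integrable_exp_neg_norm[of "c / 4"] c by (intro integrable_mult_right) auto
  show ?thesis
  proof (rule has_derivativeI_sandwich[where e = "c / 2" and H = "\<lambda>y. B * norm (y - x)"])
    show "0 < c / 2" using c by simp
    show "bounded_linear (\<lambda>h. - laplace L (\<lambda>y. (h \<bullet> y) *\<^sub>R q y) x)"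
      using lin by (intro bounded_linear_minus) (simp add: linear_conv_bounded_linear)
    show "((\<lambda>y. B * norm (y - x)) \<longlongrightarrow> 0) (at x)"
      by (rule tendsto_eq_intros refl)+ simp
  next
    fix z assume z: "z \<noteq> x" "dist z x < c / 2"
    define h where "h = z - x"
    have h: "norm h < c / 2" "h \<noteq> 0" and zh: "z = x + h" using z by (auto simp: h_def dist_norm)
    have intz: "set_integrable lborel L (\<lambda>y. exp (- (z \<bullet> y)) *\<^sub>R q y)"
    proof (rule laplace_integrable[OF L _ _ q])
      show "c / 2 > 0" using c by simp
      fix y assume y: "y \<in> L"
      have "\<bar>h \<bullet> y\<bar> \<le> c / 2 * norm y"
        using Cauchy_Schwarz_ineq2[of h y] mult_right_mono[of "norm h" "c / 2" "norm y"] h by simp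
      then show "c / 2 * norm y \<le> z \<bullet> y"
        using c(2)[OF y] by (simp add: zh inner_add_left)
    qed
    define R where "R = (\<lambda>y. exp (- (x \<bullet> y)) *\<^sub>R (exp (- (h \<bullet> y)) - 1 + h \<bullet> y) *\<^sub>R q y)"
    have R: "R y = exp (- (z \<bullet> y)) *\<^sub>R q y - exp (- (x \<bullet> y)) *\<^sub>R q y + exp (- (x \<bullet> y)) *\<^sub>R (h \<bullet> y) *\<^sub>R q y" for y
      by (simp add: R_def zh inner_add_left exp_diff exp_minus algebra_simps exp_add divide_inverse)
    have intR: "set_integrable lborel L R"
      unfolding R by (intro set_integral_add(1) set_integral_diff(1) intz int0 int)
    have "laplace L q z - laplace L q x - - laplace L (\<lambda>y. ((z - x) \<bullet> y) *\<^sub>R q y) x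
        = (LINT y:L|lborel. R y)"
      unfolding R laplace_def h_def[symmetric]
        set_integral_add(2)[OF set_integral_diff(1)[OF intz int0] int] set_integral_diff(2)[OF intz int0]
      by simp
    moreover have "norm (LINT y:L|lborel. R y) \<le> (norm h)\<^sup>2 * B"
    proof -
      have "norm (LINT y:L|lborel. R y) \<le> (\<integral>y. (norm h)\<^sup>2 * (C * exp (- (c / 4 * norm (y::'a)))) \<partial>lborel)"
        unfolding set_lebesgue_integral_def
      proof (rule Bochner_Integration.integral_norm_bound_integral)
        show "integrable lborel (\<lambda>y. indicat_real L y *\<^sub>R R y)"
          using intR by (simp add: set_integrable_def)
        show "integrable lborel (\<lambda>y::'a. (norm h)\<^sup>2 * (C * exp (- (c / 4 * norm y))))"
          using intB by (rule integrable_mult_right)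
        fix y
        have C0: "C \<ge> 0" using order_trans[OF norm_ge_zero C[of 0]] by simp
        have "norm (R y) \<le> (norm h)\<^sup>2 * (C * exp (- (c / 4 * norm y)))" if y: "y \<in> L"
        proof -
          have hy: "\<bar>h \<bullet> y\<bar> \<le> norm h * norm y" by (rule Cauchy_Schwarz_ineq2)
          have hy2: "\<bar>h \<bullet> y\<bar> \<le> c / 2 * norm y"
            using hy mult_right_mono[of "norm h" "c / 2" "norm y"] h by simp
          have "(h \<bullet> y)\<^sup>2 \<le> (norm h)\<^sup>2 * (norm y)\<^sup>2"
            using power_mono[OF hy, of 2] by (simp add: power_mult_distrib)
          then have "\<bar>exp (- (h \<bullet> y)) - 1 + h \<bullet> y\<bar> \<le> ((norm h)\<^sup>2 * (norm y)\<^sup>2) * exp (c / 2 * norm y)"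
            using exp_remainder_bound[of "h \<bullet> y"] hy2
            by (elim order_trans) (intro mult_mono, auto)
          then have "norm (R y) \<le> exp (- (c * norm y)) * (((norm h)\<^sup>2 * (norm y)\<^sup>2) * exp (c / 2 * norm y) * norm (q y))"
            using c(2)[OF y] unfolding R_def norm_scaleR
            by (intro mult_mono mult_right_mono) auto
          also have "\<dots> = (norm h)\<^sup>2 * exp (- (c * norm y)) * exp (c / 2 * norm y) * norm ((norm y)\<^sup>2 *\<^sub>R q y)"
            by simp
          also have "\<dots> \<le> (norm h)\<^sup>2 * exp (- (c * norm y)) * exp (c / 2 * norm y) * (C * exp (c / 4 * norm y))"
            by (intro mult_left_mono C) auto
          also have "\<dots> = (norm h)\<^sup>2 * (C * exp (- (c * norm y) + c / 2 * norm y + c / 4 * norm y))"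
            by (simp only: exp_add mult_ac)
          also have "- (c * norm y) + c / 2 * norm y + c / 4 * norm y = - (c / 4 * norm y)" by simp
          finally show ?thesis .
        qed
        then show "norm (indicat_real L y *\<^sub>R R y) \<le> (norm h)\<^sup>2 * (C * exp (- (c / 4 * norm y)))"
          using C0 by (auto simp: indicator_def)
      qed
      also have "\<dots> = (norm h)\<^sup>2 * B" by (simp add: B_def)
      finally show ?thesis .
    qed
    ultimately have "norm (laplace L q z - laplace L q x - - laplace L (\<lambda>y. ((z - x) \<bullet> y) *\<^sub>R q y) x)
       \<le> (norm (z - x))\<^sup>2 * B" by (simp add: h_def)
    then show "norm (laplace L q z - laplace L q x - - laplace L (\<lambda>y. ((z - x) \<bullet> y) *\<^sub>R q y) x) / norm (z - x)
       \<le> B * norm (z - x)"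
      using z by (simp add: field_simps power2_eq_square)
  qed
qed

lemma integral_pos_of_open:
  fixes f :: "'a::euclidean_space \<Rightarrow> real"
  assumes f: "integrable lborel f" "\<And>y. 0 \<le> f y" and U: "open U" "U \<noteq> {}" "\<And>y. y \<in> U \<Longrightarrow> f y > 0"
  shows "integral\<^sup>L lborel f > 0"
proof (rule ccontr)
  assume "\<not> ?thesis"
  moreover have "integral\<^sup>L lborel f \<ge> 0" using f by (intro integral_nonneg_AE) auto
  ultimately have "integral\<^sup>L lborel f = 0" by linarith
  then have "AE y in lborel. f y = 0"
    using f by (subst (asm) integral_nonneg_eq_0_iff_AE) auto
  then have "AE y in lborel. y \<notin> U"
    by eventually_elim (use U(3) in force)
  then have "AE y in lebesgue. y \<notin> U" by (rule AE_completion)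
  then have "negligible U"
    using negligible_iff_null_sets AE_iff_null_sets[of U lebesgue] U(1) by (auto simp: borel_open)
  then show False using open_not_negligible[OF U(1,2)] by simp
qed

lemma nn_integral_lborel_translate:
  fixes f :: "'a::euclidean_space \<Rightarrow> ennreal"
  assumes [measurable]: "f \<in> borel_measurable borel"
  shows "(\<integral>\<^sup>+x. f (a + x) \<partial>lborel) = (\<integral>\<^sup>+x. f x \<partial>lborel)"
proof -
  have "(\<integral>\<^sup>+x. f x \<partial>lborel) = (\<integral>\<^sup>+x. f x \<partial>distr lborel borel ((+) a))"
    by (simp add: lborel_distr_plus)
  also have "\<dots> = (\<integral>\<^sup>+x. f (a + x) \<partial>lborel)"
    by (rule nn_integral_distr) simp_all
  finally show ?thesis ..
qed

lemma nn_integral_lborel_reflect: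
  fixes f :: "'a::euclidean_space \<Rightarrow> ennreal"
  assumes [measurable]: "f \<in> borel_measurable borel"
  shows "(\<integral>\<^sup>+x. f (a - x) \<partial>lborel) = (\<integral>\<^sup>+x. f x \<partial>lborel)"
proof -
  have "(\<integral>\<^sup>+x. f x \<partial>lborel) = (\<integral>\<^sup>+x. f x \<partial>density (distr lborel borel (\<lambda>x. a + (-1) *\<^sub>R x)) (\<lambda>_. \<bar>-1::real\<bar> ^ DIM('a)))"
    by (subst lborel_affine[of "-1" a]) simp_all
  also have "\<dots> = (\<integral>\<^sup>+x. f x \<partial>distr lborel borel (\<lambda>x. a - x))"
    by (simp add: density_1)
  also have "\<dots> = (\<integral>\<^sup>+x. f (a - x) \<partial>lborel)"
    by (rule nn_integral_distr) simp_all
  finally show ?thesis ..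
qed

text \<open>A linear bijection scales Lebesgue measure by a constant factor; this form of the statement avoids
naming the factor. Both sides are the double integral of \<open>f (A x + y) * g y\<close>, by the usual argument
for the uniqueness of Haar measure: translation invariance in \<open>x\<close> gives the left-hand side,
translation in \<open>y\<close> followed by a reflection in \<open>x\<close> gives the right-hand side.\<close>

lemma nn_integral_linear_image_ratio:
  fixes A :: "'a::euclidean_space \<Rightarrow> 'a" and f g :: "'a \<Rightarrow> ennreal"
  assumes A: "linear A" "bij A" and [measurable]: "f \<in> borel_measurable borel" "g \<in> borel_measurable borel"
  shows "(\<integral>\<^sup>+x. f (A x) \<partial>lborel) * (\<integral>\<^sup>+y. g y \<partial>lborel) = (\<integral>\<^sup>+y. f y \<partial>lborel) * (\<integral>\<^sup>+x. g (A x) \<partial>lborel)"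
proof -
  have [measurable]: "A \<in> borel_measurable borel"
    using A(1) by (intro borel_measurable_continuous_onI linear_continuous_on) (simp add: linear_conv_bounded_linear)
  have inv: "A (inv A y) = y" for y using A(2) by (simp add: bij_is_surj surj_f_inv_f)
  have "(\<integral>\<^sup>+x. f (A x) \<partial>lborel) * (\<integral>\<^sup>+y. g y \<partial>lborel) = (\<integral>\<^sup>+y. (\<integral>\<^sup>+x. f (A x) \<partial>lborel) * g y \<partial>lborel)"
    by (simp add: nn_integral_cmult)
  also have "\<dots> = (\<integral>\<^sup>+y. (\<integral>\<^sup>+x. f (A x + y) * g y \<partial>lborel) \<partial>lborel)"
  proof (rule nn_integral_cong)
    fix y
    have "(\<integral>\<^sup>+x. f (A x) \<partial>lborel) = (\<integral>\<^sup>+x. f (A (inv A y + x)) \<partial>lborel)"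
      by (rule nn_integral_lborel_translate[symmetric]) simp
    also have "\<dots> = (\<integral>\<^sup>+x. f (A x + y) \<partial>lborel)"
      by (simp add: linear_add[OF A(1)] inv add.commute)
    finally show "(\<integral>\<^sup>+x. f (A x) \<partial>lborel) * g y = (\<integral>\<^sup>+x. f (A x + y) * g y \<partial>lborel)"
      by (simp add: nn_integral_multc)
  qed
  also have "\<dots> = (\<integral>\<^sup>+x. (\<integral>\<^sup>+y. f (A x + y) * g y \<partial>lborel) \<partial>lborel)"
    by (rule lborel_pair.Fubini') simp
  also have "\<dots> = (\<integral>\<^sup>+x. (\<integral>\<^sup>+y. f y * g (y - A x) \<partial>lborel) \<partial>lborel)"
  proof (rule nn_integral_cong)
    fix x
    show "(\<integral>\<^sup>+y. f (A x + y) * g y \<partial>lborel) = (\<integral>\<^sup>+y. f y * g (y - A x) \<partial>lborel)"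
      using nn_integral_lborel_translate[of "\<lambda>y. f y * g (y - A x)" "A x"] by simp
  qed
  also have "\<dots> = (\<integral>\<^sup>+y. (\<integral>\<^sup>+x. f y * g (y - A x) \<partial>lborel) \<partial>lborel)"
    by (rule lborel_pair.Fubini'[symmetric]) simp
  also have "\<dots> = (\<integral>\<^sup>+y. f y * (\<integral>\<^sup>+x. g (A x) \<partial>lborel) \<partial>lborel)"
  proof (rule nn_integral_cong)
    fix y
    have "(\<integral>\<^sup>+x. g (A x) \<partial>lborel) = (\<integral>\<^sup>+x. g (A (inv A y - x)) \<partial>lborel)"
      by (rule nn_integral_lborel_reflect[symmetric]) simp
    also have "\<dots> = (\<integral>\<^sup>+x. g (y - A x) \<partial>lborel)"
      by (simp add: linear_diff[OF A(1)] inv)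
    finally show "(\<integral>\<^sup>+x. f y * g (y - A x) \<partial>lborel) = f y * (\<integral>\<^sup>+x. g (A x) \<partial>lborel)"
      by (simp add: nn_integral_cmult)
  qed
  also have "\<dots> = (\<integral>\<^sup>+y. f y \<partial>lborel) * (\<integral>\<^sup>+x. g (A x) \<partial>lborel)"
    by (simp add: nn_integral_multc)
  finally show ?thesis .
qed

lemma closed_dual_cone: "closed (dual_cone K)"
proof -
  have "dual_cone K = (\<Inter>x\<in>K. {s. 0 \<le> x \<bullet> s})" by (auto simp: dual_cone_wrt_def)
  then show ?thesis by (auto simp: closed_halfspace_ge intro!: closed_INT)
qed

text \<open>A whole ball around \<open>x\<close> lies in \<open>K\<close>, and the point of that ball furthest against \<open>y\<close> still has
non-negative inner product with \<open>y\<close>.\<close>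

lemma interior_inner_bound:
  fixes K :: "'a::euclidean_space set"
  assumes x: "x \<in> interior K" 
  shows "\<exists>c>0. \<forall>y\<in>dual_cone K. c * norm y \<le> x \<bullet> y"
proof -
  obtain r where r: "r > 0" "cball x r \<subseteq> K" using x by (meson mem_interior_cball)
  have "r * norm y \<le> x \<bullet> y" if y: "y \<in> dual_cone K" for y
  proof (cases "y = 0")
    case False
    have "x - (r / norm y) *\<^sub>R y \<in> K"
      using r False by (auto simp: subset_iff dist_norm)
    then have "0 \<le> (x - (r / norm y) *\<^sub>R y) \<bullet> y" using y by (auto simp: dual_cone_wrt_def)
    also have "\<dots> = x \<bullet> y - r * norm y"
      using False by (simp add: inner_diff_left dot_square_norm power2_eq_square)
    finally show ?thesis by simp
  qed simp
  with r show ?thesis by blast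
qed

lemma char_fun_eq_laplace: "char_fun K = laplace (dual_cone K) (\<lambda>_. 1)"
  by (rule ext) (simp add: char_fun_def laplace_def)

lemma laplace_integrable_interior:
  assumes "x \<in> interior K" "subexponential q"
  shows "set_integrable lborel (dual_cone K) (\<lambda>y. exp (- (x \<bullet> y)) *\<^sub>R q y)"
  using interior_inner_bound[OF assms(1)] laplace_integrable[OF borel_closed[OF closed_dual_cone] _ _ assms(2)] by blast

lemma laplace_has_derivative_interior:
  assumes "x \<in> interior K" "subexponential q"
  shows "(laplace (dual_cone K) q has_derivative (\<lambda>h. - laplace (dual_cone K) (\<lambda>y. (h \<bullet> y) *\<^sub>R q y) x)) (at x)"
  using interior_inner_bound[OF assms(1)] laplace_has_derivative[OF borel_closed[OF closed_dual_cone] _ _ assms(2)] by blast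

lemma laplace_pos:
  assumes x: "x \<in> interior K" and q: "subexponential q"
    and L: "interior (dual_cone K) \<noteq> {}"
    and pos: "\<And>y. y \<in> dual_cone K \<Longrightarrow> 0 \<le> q y" "\<And>y. y \<in> dual_cone K \<Longrightarrow> y \<noteq> 0 \<Longrightarrow> (0::real) < q y"
  shows "laplace (dual_cone K) q x > 0"
proof -
  \<comment> \<open>the origin is left out because \<open>q\<close> may vanish there\<close>
  let ?U = "interior (dual_cone K) - {0}"
  have "?U \<noteq> {}"
  proof
    assume "?U = {}"
    then have "interior (dual_cone K) = {0}" using L by auto
    then show False by (metis not_open_singleton open_interior)
  qed
  moreover have "y \<in> dual_cone K" if "y \<in> ?U" for y using that interior_subset by blast
  ultimately show ?thesis
    using laplace_integrable_interior[OF x q] pos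
    unfolding laplace_def set_lebesgue_integral_def set_integrable_def
    by (intro integral_pos_of_open[where U = ?U]) (auto simp: indicator_def)
qed

lemma char_fun_pos:
  assumes "x \<in> interior K" "interior (dual_cone K) \<noteq> {}"
  shows "char_fun K x > 0"
  unfolding char_fun_eq_laplace by (rule laplace_pos[OF assms(1) subexponential_const assms(2)]) auto

text \<open>The adjoint of \<open>A\<close> preserves the dual cone and carries the integrand of \<open>\<phi>\<close> at \<open>x\<close> to the integrand
at \<open>A x\<close>, so \<open>\<phi> (A x) / \<phi> x\<close> is the factor by which a linear map changes volumes and does not depend
on \<open>x\<close>.\<close>

lemma char_fun_automorphism_ratio:
  assumes A: "linear A" "bij A" "A ` K = K" and x: "x \<in> interior K" and e: "e \<in> interior K"
  shows "A x \<in> interior K"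
    and "char_fun K (A x) * char_fun K e = char_fun K x * char_fun K (A e)"
proof -
  have inK: "A x \<in> interior K" if "x \<in> interior K" for x
    using interior_bijective_linear_image[OF A(1,2), of K] that A(3) by auto
  then show "A x \<in> interior K" using x .
  define f where "f = (\<lambda>x y. ennreal (indicator (dual_cone K) y *\<^sub>R exp (- (x \<bullet> y))))"
  have [measurable]: "dual_cone K \<in> sets borel" by (rule borel_closed[OF closed_dual_cone])
  have fm: "f x \<in> borel_measurable borel" for x unfolding f_def by measurable
  have fint: "(\<integral>\<^sup>+y. f x y \<partial>lborel) = ennreal (char_fun K x)" if "x \<in> interior K" for x
    unfolding f_def char_fun_def set_lebesgue_integral_def
    using laplace_integrable_interior[OF that subexponential_const[of "1::real"]]
    by (intro nn_integral_eq_integral) (auto simp: set_integrable_def)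
  let ?B = "adjoint A"
  have B: "linear ?B" by (rule adjoint_linear[OF A(1)])
  have adj: "x \<bullet> ?B y = A x \<bullet> y" for x y by (rule adjoint_works[OF A(1)])
  have "inj ?B"
  proof (rule linear_injective_0[OF B, THEN iffD2], intro allI impI)
    fix y assume "?B y = 0"
    then have "A x \<bullet> y = 0" for x using adj[of x y] by simp
    from this[of "inv A y"] show "y = 0" using A(2) by (simp add: bij_is_surj surj_f_inv_f)
  qed
  then have bijB: "bij ?B" using linear_injective_imp_surjective[OF B] by (simp add: bij_def)
  have "?B y \<in> dual_cone K \<longleftrightarrow> y \<in> dual_cone K" for y
  proof -
    have "?B y \<in> dual_cone K \<longleftrightarrow> (\<forall>x\<in>A ` K. 0 \<le> x \<bullet> y)" by (simp add: dual_cone_wrt_def adj)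
    then show ?thesis by (simp add: A(3) dual_cone_wrt_def)
  qed
  then have fB: "f x (?B y) = f (A x) y" for x y by (simp add: f_def adj indicator_def)
  have nonneg: "0 \<le> char_fun K x" for x
    unfolding char_fun_def set_lebesgue_integral_def by (intro integral_nonneg_AE) auto
  from nn_integral_linear_image_ratio[OF B bijB fm[of x] fm[of e]]
  have "ennreal (char_fun K (A x)) * ennreal (char_fun K e) = ennreal (char_fun K x) * ennreal (char_fun K (A e))"
    using x e inK by (simp add: fB fint)
  then show "char_fun K (A x) * char_fun K e = char_fun K x * char_fun K (A e)"
    using nonneg by (simp add: ennreal_mult[symmetric] ennreal_inj mult_nonneg_nonneg)
qed

text \<open>With the moments \<open>\<phi>\<close>, \<open>b = \<integral> y exp (- \<langle>x, y\<rangle>)\<close> and \<open>c h = \<integral> \<langle>h, y\<rangle> y exp (- \<langle>x, y\<rangle>)\<close> the gradient of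
\<open>ln \<phi>\<close> is \<open>- b / \<phi>\<close>, and its Hessian is the covariance operator
\<open>h \<mapsto> c h / \<phi> - \<langle>h, b\<rangle> b / \<phi>\<^sup>2\<close>.\<close>

lemma log_char_fun_derivatives:
  fixes K :: "'a::euclidean_space set"
  assumes L: "interior (dual_cone K) \<noteq> {}"
  obtains g :: "'a \<Rightarrow> 'a" and M and M' where
    "\<And>x. x \<in> interior K \<Longrightarrow> ((\<lambda>x. ln (char_fun K x)) has_derivative (\<lambda>h. g x \<bullet> h)) (at x)"
    "\<And>x. x \<in> interior K \<Longrightarrow> (g has_derivative M x) (at x)"
    "\<And>x u v. x \<in> interior K \<Longrightarrow> M x u \<bullet> v = u \<bullet> M x v"
    "\<And>x k. x \<in> interior K \<Longrightarrow> ((\<lambda>y. M y k) has_derivative (\<lambda>h. M' x h k)) (at x)"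
    "\<And>x h k. x \<in> interior K \<Longrightarrow> M' x h k = M' x k h"
    "\<And>x. x \<in> interior K \<Longrightarrow> g x \<bullet> x < 0"
proof -
  define P where "P = char_fun K"
  define b where "b = laplace (dual_cone K) (\<lambda>y::'a. y)"
  define c where "c = (\<lambda>h. laplace (dual_cone K) (\<lambda>y::'a. (h \<bullet> y) *\<^sub>R y))"
  have sc: "subexponential (\<lambda>y::'a. (h \<bullet> y) *\<^sub>R y)" for h
    by (rule subexponential_scale[OF subexponential_inner subexponential_id])
  have inner_laplace: "h \<bullet> laplace (dual_cone K) q x = laplace (dual_cone K) (\<lambda>y. h \<bullet> q y) x"
    if "x \<in> interior K" "subexponential q" for h :: 'a and q :: "'a \<Rightarrow> 'a" and x
    using laplace_integrable_interior[OF that]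
    unfolding laplace_def set_lebesgue_integral_def set_integrable_def
    by (subst integral_inner_right[symmetric]) (simp_all add: mult.assoc)
  have P0: "P x > 0" if "x \<in> interior K" for x using char_fun_pos[OF that L] by (simp add: P_def)
  have dP: "(P has_derivative (\<lambda>h. - (h \<bullet> b x))) (at x)" if "x \<in> interior K" for x
    using laplace_has_derivative_interior[OF that subexponential_const[of "1::real"]]
    by (simp add: P_def char_fun_eq_laplace b_def inner_laplace[OF that subexponential_id])
  have db: "(b has_derivative (\<lambda>h. - c h x)) (at x)" if "x \<in> interior K" for x
    using laplace_has_derivative_interior[OF that subexponential_id] by (simp add: b_def c_def)
  have dc: "(c k has_derivative (\<lambda>h. - laplace (dual_cone K) (\<lambda>y. (h \<bullet> y) *\<^sub>R (k \<bullet> y) *\<^sub>R y) x)) (at x)"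
    if "x \<in> interior K" for x k
    using laplace_has_derivative_interior[OF that sc] by (simp add: c_def)
  have csym: "c u x \<bullet> v = u \<bullet> c v x" if "x \<in> interior K" for x u v
    unfolding c_def inner_commute[of _ v]
    by (simp add: inner_laplace[OF that sc] mult.commute)
  define g where "g = (\<lambda>x. - (inverse (P x) *\<^sub>R b x))"
  define M where "M = (\<lambda>x h. inverse (P x) *\<^sub>R c h x - ((h \<bullet> b x) * (inverse (P x))\<^sup>2) *\<^sub>R b x)"
  have dg: "(g has_derivative M x) (at x)" if x: "x \<in> interior K" for x
    unfolding g_def M_def using P0[OF x]
    by (auto intro!: derivative_eq_intros dP[OF x] db[OF x] simp: fun_eq_iff algebra_simps power2_eq_square)
  have Mdiff: "(\<lambda>y. M y k) differentiable (at x)" if x: "x \<in> interior K" for x k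
  proof -
    have "P differentiable (at x)" "b differentiable (at x)" "c k differentiable (at x)"
      using dP[OF x] db[OF x] dc[OF x] by (auto simp: differentiable_def)
    then show ?thesis unfolding M_def using P0[OF x]
      by (auto intro!: derivative_intros)
  qed
  define M' where "M' = (\<lambda>x h k. frechet_derivative (\<lambda>y. M y k) (at x) h)"
  have dM: "((\<lambda>y. M y k) has_derivative (\<lambda>h. M' x h k)) (at x)" if "x \<in> interior K" for x k
    using Mdiff[OF that] by (simp add: M'_def frechet_derivative_works)
  show thesis
  proof (rule that)
    fix x assume x: "x \<in> interior K"
    show "((\<lambda>x. ln (char_fun K x)) has_derivative (\<lambda>h. g x \<bullet> h)) (at x)"
      using has_derivative_ln[OF P0[OF x] dP[OF x]]
      by (simp add: P_def g_def inner_commute divide_inverse mult.commute)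
    show "(g has_derivative M x) (at x)" using x by (rule dg)
    show "M x u \<bullet> v = u \<bullet> M x v" for u v
      by (simp add: M_def inner_diff_left inner_diff_right csym[OF x] inner_commute[of _ "b x"])
    show "((\<lambda>y. M y k) has_derivative (\<lambda>h. M' x h k)) (at x)" for k using x by (rule dM)
    show "M' x h k = M' x k h" for h k
    proof -
      have "M' x h k \<bullet> l = M' x k h \<bullet> l" for l
      proof -
        let ?f = "\<lambda>y. g y \<bullet> l"
        have df: "(?f has_derivative (\<lambda>h. M y h \<bullet> l)) (at y)" if "y \<in> interior K" for y
          by (rule has_derivative_inner_left[OF dg[OF that]])
        have dDf: "((\<lambda>y. D1 ?f y h) has_derivative (\<lambda>k. M' x k h \<bullet> l)) (at x)" for h
          by (rule has_derivative_transform_within_open[OF has_derivative_inner_left[OF dM[OF x]] open_interior x])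
            (simp add: D1_unique[OF df])
        have "D2 ?f x h k = D2 ?f x k h"
          by (rule D2_symmetric[OF open_interior x])
             (use df dDf in \<open>auto simp: differentiable_def\<close>)
        then show ?thesis by (simp add: D2_def D1_unique[OF dDf])
      qed
      then show ?thesis by (metis vector_eq_rdot)
    qed
    have "x \<bullet> b x > 0"
      unfolding b_def inner_laplace[OF x subexponential_id]
    proof (rule laplace_pos[OF x subexponential_inner L])
      obtain c where c: "c > 0" "\<And>y. y \<in> dual_cone K \<Longrightarrow> c * norm y \<le> x \<bullet> y"
        using interior_inner_bound[OF x] by blast
      fix y assume y: "y \<in> dual_cone K"
      show "0 \<le> x \<bullet> y" using c(2)[OF y] c(1) by (meson mult_nonneg_nonneg norm_ge_zero order_trans less_imp_le)
      show "0 < x \<bullet> y" if "y \<noteq> 0" using c(2)[OF y] c(1) that by (smt (verit) mult_pos_pos zero_less_norm_iff)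
    qed
    then show "g x \<bullet> x < 0" using P0[OF x] by (simp add: g_def inner_commute)
  qed
qed

section \<open>Projections and irreducible cones\<close>

text \<open>For small \<open>\<epsilon> > 0\<close> the operator \<open>1 + \<epsilon> p\<close> keeps the single point \<open>e\<close> in the interior; commuting with a
transitive family, it then keeps every interior point in the interior, and so do its powers. The
normalised powers \<open>(1 + \<epsilon>)\<^sup>-\<^sup>n (1 + \<epsilon> p)\<^sup>n\<close> converge to \<open>p\<close>.\<close>

lemma projection_preserves_cone:
  fixes K :: "'a::euclidean_space set"
  assumes K: "convex_cone K" "closed K" and e: "e \<in> interior K"
    and p: "linear p" "\<And>x. p (p x) = p x"
    and trans: "\<And>x. x \<in> interior K \<Longrightarrow>
      \<exists>Q. linear Q \<and> Q ` interior K \<subseteq> interior K \<and> Q e = x \<and> (\<forall>v. Q (p v) = p (Q v))"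
  shows "p ` K \<subseteq> K"
proof -
  have "((\<lambda>t. e + t *\<^sub>R p e) \<longlongrightarrow> e + 0 *\<^sub>R p e) (at_right 0)" by (intro tendsto_intros)
  from topological_tendstoD[OF this open_interior, of K]
  have "\<forall>\<^sub>F t in at_right 0. e + t *\<^sub>R p e \<in> interior K"
    using e by simp
  then obtain b where b: "b > 0" "\<And>t. 0 < t \<Longrightarrow> t < b \<Longrightarrow> e + t *\<^sub>R p e \<in> interior K"
    unfolding eventually_at_right_field by blast
  define \<epsilon> where "\<epsilon> = b / 2"
  have \<epsilon>: "\<epsilon> > 0" "e + \<epsilon> *\<^sub>R p e \<in> interior K"
    using b by (auto simp: \<epsilon>_def)
  have step: "y + \<epsilon> *\<^sub>R p y \<in> interior K" if y: "y \<in> interior K" for y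
  proof -
    obtain Q where Q: "linear Q" "Q ` interior K \<subseteq> interior K" "Q e = y" "\<And>v. Q (p v) = p (Q v)"
      using trans[OF y] by blast
    have "Q (e + \<epsilon> *\<^sub>R p e) = y + \<epsilon> *\<^sub>R p y"
      by (simp add: linear_add[OF Q(1)] linear_cmul[OF Q(1)] Q)
    with Q(2) \<epsilon>(2) show ?thesis by (metis imageI subsetD)
  qed
  have iter: "y + ((1 + \<epsilon>) ^ n - 1) *\<^sub>R p y \<in> interior K" if "y \<in> interior K" for y n
  proof (induction n)
    case (Suc n)
    let ?z = "y + ((1 + \<epsilon>) ^ n - 1) *\<^sub>R p y"
    have "?z + \<epsilon> *\<^sub>R p ?z = y + ((1 + \<epsilon>) ^ Suc n - 1) *\<^sub>R p y"
      by (simp add: linear_add[OF p(1)] linear_diff[OF p(1)] linear_cmul[OF p(1)] p(2) algebra_simps)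
    with step[OF Suc] show ?case by simp
  qed (use that in simp)
  have int: "p y \<in> K" if y: "y \<in> interior K" for y
  proof -
    define r where "r = inverse (1 + \<epsilon>)"
    have r: "0 < r" "r < 1" using \<epsilon>(1) by (auto simp: r_def field_simps)
    have lim: "(\<lambda>n. r ^ n *\<^sub>R y + (1 - r ^ n) *\<^sub>R p y) \<longlonglongrightarrow> 0 *\<^sub>R y + (1 - 0) *\<^sub>R p y"
      using r by (intro tendsto_intros LIMSEQ_power_zero) auto
    have mem: "r ^ n *\<^sub>R y + (1 - r ^ n) *\<^sub>R p y \<in> K" for n
    proof -
      have "r ^ n * ((1 + \<epsilon>) ^ n - 1) = 1 - r ^ n"
        using \<epsilon>(1) by (simp add: r_def power_inverse right_diff_distrib)
      then have "r ^ n *\<^sub>R y + (1 - r ^ n) *\<^sub>R p y = r ^ n *\<^sub>R (y + ((1 + \<epsilon>) ^ n - 1) *\<^sub>R p y)"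
        by (simp add: scaleR_add_right)
      also have "\<dots> \<in> K"
        using iter[OF y, of n] interior_subset r by (intro convex_cone_scaleR[OF K(1)]) auto
      finally show ?thesis .
    qed
    show ?thesis using closed_sequentially[OF K(2) mem lim] by simp
  qed
  have "closure (interior K) = K"
    using convex_closure_interior[of K] K e by (auto simp: convex_cone_def)
  then have "p ` K = p ` closure (interior K)" by simp
  also have "\<dots> \<subseteq> closure (p ` interior K)"
    by (rule closure_linear_image_subset[OF p(1)])
  also have "\<dots> \<subseteq> K" using int K(2) by (intro closure_minimal) auto
  finally show ?thesis .
qed

text \<open>Otherwise the range and the kernel of \<open>p\<close> are non-zero, and \<open>K\<close> is the sum of its intersections with
them.\<close>

lemma irreducible_cone_projection_trivial:
  fixes K :: "'a::euclidean_space set"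
  assumes irr: "irreducible_cone K" and p: "linear p" "\<And>x. p (p x) = p x"
    and pK: "p ` K \<subseteq> K" "(\<lambda>x. x - p x) ` K \<subseteq> K" and nz: "p u \<noteq> 0"
  shows "p x = x"
proof (rule ccontr)
  assume x: "p x \<noteq> x"
  define E where "E = (\<lambda>i::nat. if i = 0 then range p else range (\<lambda>x. x - p x))"
  define C where "C = (\<lambda>i::nat. E i \<inter> K)"
  have K: "convex_cone K" using irr by (simp add: irreducible_cone_def)
  have q: "linear (\<lambda>x. x - p x)" by (intro linear_compose_sub p linear_ident)
  have pq: "p (x - p x) = 0" for x by (simp add: linear_diff[OF p(1)] p(2))
  have mem0: "v \<in> E 0 \<longleftrightarrow> p v = v" for v using p(2) by (auto simp: E_def image_iff) metis
  have mem1: "v \<in> E (Suc 0) \<longleftrightarrow> p v = 0" for v using pq by (auto simp: E_def image_iff) (metis diff_zero)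
  have "direct_sum_decomp 2 E"
    unfolding direct_sum_decomp_def
  proof (intro conjI allI impI)
    fix i show "subspace (E i)"
      using linear_subspace_image[OF p(1) subspace_UNIV] linear_subspace_image[OF q subspace_UNIV] by (simp add: E_def)
  next
    fix x
    show "\<exists>!y. (\<forall>i<2. y i \<in> E i) \<and> (\<forall>i\<ge>2. y i = 0) \<and> x = (\<Sum>i<2. y i)"
    proof (rule ex1I[of _ "\<lambda>i. if i = 0 then p x else if i = 1 then x - p x else 0"])
      show "(\<forall>i<2::nat. (if i = 0 then p x else if i = 1 then x - p x else 0) \<in> E i) \<and>
        (\<forall>i\<ge>2::nat. (if i = 0 then p x else if i = 1 then x - p x else 0) = 0) \<and>
        x = (\<Sum>i<2::nat. if i = 0 then p x else if i = 1 then x - p x else 0)"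
        by (auto simp: numeral_2_eq_2 less_Suc_eq mem0 mem1 p(2) pq)
      fix y assume y: "(\<forall>i<2. y i \<in> E i) \<and> (\<forall>i\<ge>2. y i = 0) \<and> x = (\<Sum>i<2. y i)"
      then have s: "x = y 0 + y 1" "p (y 0) = y 0" "p (y 1) = 0"
        by (auto simp: numeral_2_eq_2 less_Suc_eq mem0 mem1)
      then have "p x = y 0" by (simp add: linear_add[OF p(1)])
      show "y = (\<lambda>i. if i = 0 then p x else if i = 1 then x - p x else 0)"
      proof
        fix i :: nat
        consider "i = 0" | "i = 1" | "i \<ge> 2" by linarith
        then show "y i = (if i = 0 then p x else if i = 1 then x - p x else 0)"
          using \<open>p x = y 0\<close> s(1) y by cases auto
      qed
    qed
  qed
  moreover have "E i \<noteq> {0} \<and> cone (C i) \<and> C i \<subseteq> E i" if "i < 2" for i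
  proof -
    have sub: "subspace (E i)" using \<open>direct_sum_decomp 2 E\<close> that by (auto simp: direct_sum_decomp_def)
    have "p u \<in> E 0" "x - p x \<in> E (Suc 0)" by (auto simp: E_def)
    moreover have "x - p x \<noteq> 0" using x by auto
    ultimately have "E 0 \<noteq> {0}" "E (Suc 0) \<noteq> {0}" using nz by fastforce+
    then have "E i \<noteq> {0}" using that by (auto simp: numeral_2_eq_2 less_Suc_eq)
    moreover have "cone (C i)"
      using sub convex_cone_scaleR[OF K] by (auto simp: cone_def C_def subspace_scale)
    ultimately show ?thesis by (auto simp: C_def)
  qed
  moreover have "K = {\<Sum>i<2. y i | y. \<forall>i<2. y i \<in> C i}"
  proof
    show "K \<subseteq> {\<Sum>i<2. y i | y. \<forall>i<2. y i \<in> C i}"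
    proof
      fix v assume v: "v \<in> K"
      let ?y = "\<lambda>i::nat. if i = 0 then p v else v - p v"
      have "v = (\<Sum>i<2. ?y i)" "\<forall>i<2. ?y i \<in> C i"
        using v pK by (auto simp: numeral_2_eq_2 less_Suc_eq C_def mem0 mem1 p(2) pq)
      then show "v \<in> {\<Sum>i<2. y i | y. \<forall>i<2. y i \<in> C i}" by blast
    qed
    show "{\<Sum>i<2. y i | y. \<forall>i<2. y i \<in> C i} \<subseteq> K"
      using convex_cone_add[OF K] by (auto simp: numeral_2_eq_2 less_Suc_eq C_def)
  qed
  ultimately have "\<exists>(m::nat) E C. m \<ge> 2 \<and> direct_sum_decomp m E \<and>
          (\<forall>i<m. E i \<noteq> {0} \<and> cone (C i) \<and> C i \<subseteq> E i) \<and> K = {\<Sum>i<m. y i | y. \<forall>i<m. y i \<in> C i}"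
    by (intro exI[of _ 2] exI[of _ E] exI[of _ C]) auto
  then show False using irr unfolding irreducible_cone_def by blast
qed

text \<open>The quadratic form is minimal at \<open>u\<close>, so its gradient there vanishes; the proof moves from \<open>u\<close> a
little in the direction \<open>- B u\<close>.\<close>

lemma psd_null_vector:
  assumes B: "linear B" "\<And>u v. B u \<bullet> v = u \<bullet> B v" "\<And>u. B u \<bullet> u \<ge> 0" and u: "B u \<bullet> u = 0"
  shows "B u = 0"
proof (rule ccontr)
  assume "B u \<noteq> 0"
  define a where "a = B u \<bullet> B u"
  define b where "b = B (B u) \<bullet> B u"
  have a: "a > 0" using \<open>B u \<noteq> 0\<close> by (simp add: a_def)
  have b: "b \<ge> 0" using B(3) by (simp add: b_def)
  have q: "0 \<le> - 2 * t * a + t * t * b" for t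
  proof -
    have "0 \<le> B (u - t *\<^sub>R B u) \<bullet> (u - t *\<^sub>R B u)" by (rule B(3))
    also have "\<dots> = - 2 * t * a + t * t * b"
      using u B(2)[of "B u" u]
      by (simp add: linear_diff[OF B(1)] linear_cmul[OF B(1)] inner_diff_left inner_diff_right a_def b_def algebra_simps)
    finally show ?thesis .
  qed
  \<comment> \<open>any step small enough that the linear term dominates the quadratic one\<close>
  define t where "t = a / (b + 1)"
  have t: "t > 0" "t * b \<le> a" using a b by (auto simp: t_def field_simps)
  have "0 \<le> t * (- 2 * a + t * b)" using q[of t] by (simp add: algebra_simps)
  then have "2 * a \<le> t * b" using t(1) by (simp add: zero_le_mult_iff)
  with t(2) a show False by linarith
qed

text \<open>A maximiser of the Rayleigh quotient of \<open>M\<close> relative to \<open>H\<close>, with \<open>r\<close> the maximum: \<open>r H - M\<close> is positive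
semidefinite and vanishes on it.\<close>

lemma generalized_eigenvector_exists:
  fixes H M :: "'a::euclidean_space \<Rightarrow> 'a"
  assumes H: "linear H" "\<And>u v. H u \<bullet> v = u \<bullet> H v" "\<And>u. u \<noteq> 0 \<Longrightarrow> H u \<bullet> u > 0"
    and M: "linear M" "\<And>u v. M u \<bullet> v = u \<bullet> M v"
  shows "\<exists>r u. u \<noteq> 0 \<and> M u = r *\<^sub>R H u"
proof -
  have cont: "continuous_on S H" "continuous_on S M" for S
    using H(1) M(1) by (auto intro: linear_continuous_on simp: linear_conv_bounded_linear)
  have ne: "sphere (0::'a) 1 \<noteq> {}" by simp
  have "H v \<bullet> v \<noteq> 0" if "v \<in> sphere 0 1" for v
    using H(3)[of v] that by (cases "v = 0") auto
  then have "continuous_on (sphere 0 1) (\<lambda>u. (M u \<bullet> u) / (H u \<bullet> u))"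
    by (intro continuous_intros cont) blast
  then obtain u where u: "u \<in> sphere 0 1"
    and max: "\<And>v. v \<in> sphere 0 1 \<Longrightarrow> (M v \<bullet> v) / (H v \<bullet> v) \<le> (M u \<bullet> u) / (H u \<bullet> u)"
    using continuous_attains_sup[OF compact_sphere ne, of "\<lambda>u. (M u \<bullet> u) / (H u \<bullet> u)"] by blast
  define r where "r = (M u \<bullet> u) / (H u \<bullet> u)"
  have u0: "u \<noteq> 0" using u by auto
  define B where "B = (\<lambda>v. r *\<^sub>R H v - M v)"
  have "B u = 0"
  proof (rule psd_null_vector[of B u])
    show "linear B" unfolding B_def by (intro linear_compose_sub linear_compose_scale_right H M)
    show "B v \<bullet> w = v \<bullet> B w" for v w
      by (simp add: B_def inner_diff_left inner_diff_right H(2) M(2))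
    show "B u \<bullet> u = 0" using H(3)[OF u0] by (simp add: B_def inner_diff_left r_def)
    fix v show "B v \<bullet> v \<ge> 0"
    proof (cases "v = 0")
      case False
      define w where "w = (1 / norm v) *\<^sub>R v"
      have w: "w \<in> sphere 0 1" "v = norm v *\<^sub>R w" using False by (auto simp: w_def)
      then have "w \<noteq> 0" by auto
      then have "M w \<bullet> w \<le> r * (H w \<bullet> w)"
        using max[OF w(1)] H(3) by (simp add: r_def[symmetric] pos_divide_le_eq)
      then have "0 \<le> B w \<bullet> w" by (simp add: B_def inner_diff_left)
      moreover have "B v \<bullet> v = (norm v)\<^sup>2 * (B w \<bullet> w)"
        by (subst (1 2) w(2)) (simp add: linear_cmul[OF \<open>linear B\<close>] power2_eq_square)
      ultimately show ?thesis by simp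
    qed (simp add: B_def linear_0[OF H(1)] linear_0[OF M(1)])
  qed
  then show ?thesis using u0 by (intro exI[of _ r] exI[of _ u]) (simp add: B_def)
qed

text \<open>For the inner product given by \<open>H\<close>, the space is the direct sum of the kernel and the range of the
self-adjoint operator \<open>N\<close>; \<open>p\<close> is the projection onto the kernel along the range. Both summands are
invariant under any operator commuting with \<open>N\<close>, so \<open>p\<close> commutes with it too.\<close>

lemma kernel_projection_exists:
  fixes H N :: "'a::euclidean_space \<Rightarrow> 'a"
  assumes H: "\<And>u. u \<noteq> 0 \<Longrightarrow> H u \<bullet> u > 0" and H0: "linear H"
    and N: "linear N" "\<And>u v. H (N u) \<bullet> v = H u \<bullet> N v"
  obtains p where "linear p" "\<And>x. p (p x) = p x" "\<And>x. N (p x) = 0" "\<And>x. N x = 0 \<Longrightarrow> p x = x"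
    "\<And>Q x. linear Q \<Longrightarrow> (\<And>v. Q (N v) = N (Q v)) \<Longrightarrow> Q (p x) = p (Q x)"
proof -
  have NN: "N v = 0" if "N (N v) = 0" for v
  proof (rule ccontr)
    assume "N v \<noteq> 0"
    then have "0 < H (N v) \<bullet> N v" by (rule H)
    also have "\<dots> = H (N (N v)) \<bullet> v" by (rule N(2)[symmetric])
    finally show False using that by (simp add: linear_0[OF H0])
  qed
  have eqN: "N z = N z'" if "N (N z) = N (N z')" for z z'
    using NN[of "z - z'"] that by (simp add: linear_diff[OF N(1)])
  have ex: "\<exists>z. N (N z) = N x" for x
  proof -
    have sub: "subspace (range N)" "subspace (N ` range N)"
      by (intro linear_subspace_image N subspace_UNIV)+
    have "inj_on N (range N)" using eqN by (auto simp: inj_on_def)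
    moreover have "span (range N) = range N"
      using sub(1) by (simp only: span_eq_iff)
    ultimately have "dim (N ` range N) = dim (range N)"
      by (intro dim_image_eq N) (simp only:)
    then have "N ` range N = range N"
      using sub by (intro subspace_dim_equal) auto
    then have "N x \<in> N ` range N" by simp
    then show ?thesis by auto
  qed
  define p where "p = (\<lambda>x. x - N (SOME z. N (N z) = N x))"
  have p: "p x = x - N z" if "N (N z) = N x" for x z
  proof -
    have "N (N (SOME z. N (N z) = N x)) = N x" using that by (rule someI)
    then show ?thesis using eqN[of _ z] that by (simp add: p_def)
  qed
  show thesis
  proof (rule that)
    show "linear p"
    proof (rule linearI)
      fix x y r
      obtain z w where zw: "N (N z) = N x" "N (N w) = N y" using ex by metis
      have "N (N (z + w)) = N (x + y)" "N (N (r *\<^sub>R z)) = N (r *\<^sub>R x)"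
        using zw by (simp_all add: linear_add[OF N(1)] linear_cmul[OF N(1)])
      from p[OF this(1)] p[OF this(2)] p[OF zw(1)] p[OF zw(2)]
      show "p (x + y) = p x + p y" "p (r *\<^sub>R x) = r *\<^sub>R p x"
        by (simp_all add: linear_add[OF N(1)] linear_cmul[OF N(1)] scaleR_diff_right)
    qed
    show ker: "N (p x) = 0" for x
      using ex[of x] p by (auto simp: linear_diff[OF N(1)])
    show fix': "p x = x" if "N x = 0" for x
      using p[of 0 x] that by (simp add: linear_0[OF N(1)])
    show "p (p x) = p x" for x by (rule fix'[OF ker])
    fix Q x assume Q: "linear Q" "\<And>v. Q (N v) = N (Q v)"
    obtain z where z: "N (N z) = N x" using ex by blast
    have "N (N (Q z)) = N (Q x)" by (metis Q(2) z)
    from p[OF this] show "Q (p x) = p (Q x)"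
      by (simp add: p[OF z] linear_diff[OF Q(1)] Q(2))
  qed
qed

text \<open>A form of Schur's lemma for cones: the projection onto an eigenspace of \<open>T\<close> commutes with the
transitive family and hence splits \<open>K\<close>.\<close>

lemma irreducible_cone_commutant_scalar:
  fixes K :: "'a::euclidean_space set" and H T :: "'a \<Rightarrow> 'a"
  assumes irr: "irreducible_cone K" and K: "closed K" and e: "e \<in> interior K"
    and H: "linear H" "\<And>u v. H u \<bullet> v = u \<bullet> H v" "\<And>u. u \<noteq> 0 \<Longrightarrow> H u \<bullet> u > 0"
    and T: "linear T" "\<And>u v. H (T u) \<bullet> v = H u \<bullet> T v"
    and trans: "\<And>x. x \<in> interior K \<Longrightarrow>
      \<exists>Q. linear Q \<and> Q ` interior K \<subseteq> interior K \<and> Q e = x \<and> (\<forall>v. Q (T v) = T (Q v))"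
  shows "\<exists>r. \<forall>x. T x = r *\<^sub>R x"
proof -
  have cK: "convex_cone K" using irr by (simp add: irreducible_cone_def)
  have "\<exists>r u. u \<noteq> 0 \<and> H (T u) = r *\<^sub>R H u"
    using linear_compose[OF T(1) H(1)] T(2) H(2)
    by (intro generalized_eigenvector_exists[OF H]) (simp_all add: o_def)
  then obtain r u where u: "u \<noteq> 0" "H (T u) = r *\<^sub>R H u" by blast
  define N where "N = (\<lambda>x. T x - r *\<^sub>R x)"
  have Nlin: "linear N" unfolding N_def by (intro linear_compose_sub linear_compose_scale_right T linear_ident)
  have Nsa: "H (N x) \<bullet> y = H x \<bullet> N y" for x y
    by (simp add: N_def linear_diff[OF H(1)] linear_cmul[OF H(1)] inner_diff_left inner_diff_right T(2))
  have "H (N u) = 0" using u(2) by (simp add: N_def linear_diff[OF H(1)] linear_cmul[OF H(1)])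
  then have Nu: "N u = 0" using H(3)[of "N u"] by (cases "N u = 0") simp_all
  obtain p where p: "linear p" "\<And>x. p (p x) = p x" "\<And>x. N (p x) = 0" "\<And>x. N x = 0 \<Longrightarrow> p x = x"
    "\<And>Q x. linear Q \<Longrightarrow> (\<And>v. Q (N v) = N (Q v)) \<Longrightarrow> Q (p x) = p (Q x)"
    by (rule kernel_projection_exists[OF H(3) H(1) Nlin Nsa]) blast+
  have transp: "\<exists>Q. linear Q \<and> Q ` interior K \<subseteq> interior K \<and> Q e = x \<and> (\<forall>v. Q (p v) = p (Q v))"
    if x: "x \<in> interior K" for x
  proof -
    obtain Q where Q: "linear Q" "Q ` interior K \<subseteq> interior K" "Q e = x" "\<And>v. Q (T v) = T (Q v)"
      using trans[OF x] by blast
    have "Q (N v) = N (Q v)" for v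
      by (simp add: N_def linear_diff[OF Q(1)] linear_cmul[OF Q(1)] Q(4))
    with p(5)[OF Q(1)] Q show ?thesis by blast
  qed
  have q: "linear (\<lambda>x. x - p x)" by (intro linear_compose_sub p linear_ident)
  have pK: "p ` K \<subseteq> K" by (rule projection_preserves_cone[OF cK K e p(1,2) transp])
  have qK: "(\<lambda>x. x - p x) ` K \<subseteq> K"
  proof (rule projection_preserves_cone[OF cK K e q])
    show "(x - p x) - p (x - p x) = x - p x" for x by (simp add: linear_diff[OF p(1)] p(2))
    fix x assume "x \<in> interior K"
    from transp[OF this] obtain Q where Q: "linear Q" "Q ` interior K \<subseteq> interior K" "Q e = x" "\<forall>v. Q (p v) = p (Q v)"
      by blast
    then show "\<exists>Q. linear Q \<and> Q ` interior K \<subseteq> interior K \<and> Q e = x \<and> (\<forall>v. Q (v - p v) = Q v - p (Q v))"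
      by (intro exI[of _ Q]) (simp add: linear_diff)
  qed
  have "p u \<noteq> 0" using p(4)[OF Nu] u(1) by simp
  from irreducible_cone_projection_trivial[OF irr p(1,2) pK qK this]
  have "N x = 0" for x using p(3)[of x] by simp
  then show ?thesis by (auto simp: N_def)
qed

section \<open>Cone automorphisms from a self-scaled barrier\<close>

lemma convex_dual_cone: "convex (dual_cone K)"
  by (auto simp: convex_def dual_cone_wrt_def inner_add_right)

locale self_scaled_cone =
  fixes K :: "'a::euclidean_space set" and F :: "'a \<Rightarrow> real" and \<nu> :: real
  assumes regular: "regular_cone K"
    and barrier: "self_concordant_barrier K F"
    and hess_bij: "x \<in> interior K \<Longrightarrow> bij (hessian F x)"
    and \<nu>_pos: "\<nu> > 0"
    and log_homogeneous: "x \<in> interior K \<Longrightarrow> t > 0 \<Longrightarrow> F (t *\<^sub>R x) = F x - \<nu> * ln t"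
    and hess_dual: "x \<in> interior K \<Longrightarrow> w \<in> interior K \<Longrightarrow> hessian F w x \<in> interior (dual_cone K)"
    and hess_conjugate: "x \<in> interior K \<Longrightarrow> w \<in> interior K \<Longrightarrow>
      conjugate_barrier K F (hessian F w x) = ereal (F x - 2 * F w - \<nu>)"
begin

abbreviation "H \<equiv> hessian F"

lemma cone_facts: "convex_cone K" "closed K" "interior K \<noteq> {}" "convex K" "convex (interior K)"
  using regular by (auto simp: regular_cone_def convex_cone_def)

lemma scaling_automorphism:
  assumes t: "t > 0"
  shows "bij (\<lambda>x::'a. t *\<^sub>R x)" "(\<lambda>x. t *\<^sub>R x) ` K = K"
proof -
  have inv: "t *\<^sub>R ((1 / t) *\<^sub>R x) = x" for x :: 'a using t by simp
  show "bij (\<lambda>x::'a. t *\<^sub>R x)"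
    using t inv by (intro bijI injI surjI[where f = "\<lambda>x. (1 / t) *\<^sub>R x"]) auto
  have sub: "(\<lambda>x. s *\<^sub>R x) ` K \<subseteq> K" if "s > 0" for s
    using that convex_cone_scaleR[OF cone_facts(1)] by auto
  have "x \<in> (\<lambda>x. t *\<^sub>R x) ` K" if "x \<in> K" for x
    using sub[of "1 / t"] t inv[of x] that by (metis image_eqI image_subset_iff zero_less_divide_1_iff)
  then show "(\<lambda>x. t *\<^sub>R x) ` K = K" using sub[OF t] by blast
qed

lemma scale_interior: "x \<in> interior K \<Longrightarrow> t > 0 \<Longrightarrow> t *\<^sub>R x \<in> interior K"
  using interior_bijective_linear_image[OF linear_scaleR scaling_automorphism(1), of t K] scaling_automorphism(2)[of t]
  by auto

lemma F_diff: "x \<in> interior K \<Longrightarrow> F differentiable (at x)"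
  and D1_diff: "x \<in> interior K \<Longrightarrow> (\<lambda>y. D1 F y h) differentiable (at x)"
  and D2_diff: "x \<in> interior K \<Longrightarrow> (\<lambda>y. D2 F y h k) differentiable (at x)"
  using barrier by (auto simp: self_concordant_barrier_def numeral_3_eq_3 D2_def)

lemma D2_sym: "x \<in> interior K \<Longrightarrow> D2 F x h k = D2 F x k h"
  by (rule D2_symmetric[OF open_interior _ F_diff D1_diff])

lemma D3_swap12: "x \<in> interior K \<Longrightarrow> D3 F x h k l = D3 F x k h l"
  unfolding D3_def using D1_cong_open[OF open_interior _ D2_sym D2_diff] by metis

lemma D3_swap23: assumes x: "x \<in> interior K" shows "D3 F x h k l = D3 F x h l k"
proof -
  have "D2 (\<lambda>y. D1 F y h) x k l = D2 (\<lambda>y. D1 F y h) x l k"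
    by (rule D2_symmetric[OF open_interior x D1_diff])
       (use D2_diff[OF x] in \<open>simp_all add: D2_def\<close>)
  then show ?thesis by (simp add: D3_def D2_def)
qed

lemma inner_H: "x \<in> interior K \<Longrightarrow> H x u \<bullet> v = D2 F x u v"
  by (rule inner_hessian) (rule D1_diff)

lemma H_sym: "x \<in> interior K \<Longrightarrow> H x u \<bullet> v = u \<bullet> H x v"
  by (metis D2_sym inner_H inner_commute)

lemma H_linear: assumes x: "x \<in> interior K" shows "linear (H x)"
proof (rule linearI)
  fix u v r
  have "H x (u + v) \<bullet> w = (H x u + H x v) \<bullet> w" "H x (r *\<^sub>R u) \<bullet> w = (r *\<^sub>R H x u) \<bullet> w" for w
    by (simp_all add: H_sym[OF x] inner_add_left)
  then show "H x (u + v) = H x u + H x v" "H x (r *\<^sub>R u) = r *\<^sub>R H x u"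
    by (metis vector_eq_rdot)+
qed

definition "H' x h k = (\<Sum>b\<in>Basis. D3 F x k b h *\<^sub>R b)"

lemma H_has_derivative:
  assumes x: "x \<in> interior K"
  shows "((\<lambda>y. H y k) has_derivative (\<lambda>h. H' x h k)) (at x)"
proof -
  have "((\<lambda>y. \<Sum>b\<in>Basis. D2 F y k b *\<^sub>R b) has_derivative (\<lambda>h. H' x h k)) (at x)"
    unfolding H'_def D3_def by (intro derivative_intros D1_works D2_diff x)
  then show ?thesis
    by (rule has_derivative_transform_within_open[OF _ open_interior x])
       (simp add: inner_H[symmetric] euclidean_representation)
qed

lemma inner_H':
  assumes x: "x \<in> interior K" shows "H' x h k \<bullet> l = D3 F x k l h"
proof -
  have "((\<lambda>y. H y k \<bullet> l) has_derivative (\<lambda>h. H' x h k \<bullet> l)) (at x)"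
    by (rule has_derivative_inner_left[OF H_has_derivative[OF x]])
  then have "((\<lambda>y. D2 F y k l) has_derivative (\<lambda>h. H' x h k \<bullet> l)) (at x)"
    by (rule has_derivative_transform_within_open[OF _ open_interior x]) (rule inner_H)
  from D1_unique[OF this] show ?thesis by (simp add: D3_def)
qed

lemma H'_swap: assumes x: "x \<in> interior K" shows "H' x h k = H' x k h"
proof -
  have "H' x h k \<bullet> l = H' x k h \<bullet> l" for l
    unfolding inner_H'[OF x] by (metis D3_swap12[OF x] D3_swap23[OF x])
  then show ?thesis by (metis vector_eq_rdot)
qed

lemma H'_sym: assumes x: "x \<in> interior K" shows "H' x h k \<bullet> l = k \<bullet> H' x h l"
  by (metis D3_swap12[OF x] inner_H'[OF x] inner_commute)

lemma D1_scale_F: "x \<in> interior K \<Longrightarrow> t > 0 \<Longrightarrow> D1 F (t *\<^sub>R x) h = 1 / t * D1 F x h"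
  by (rule D1_scale[OF open_interior, where r = 1 and s = "- \<nu> * ln t" and S1 = K])
     (auto intro: F_diff scale_interior simp: log_homogeneous)

lemma D2_scale_F: "x \<in> interior K \<Longrightarrow> t > 0 \<Longrightarrow> D2 F (t *\<^sub>R x) h k = 1 / t\<^sup>2 * D2 F x h k"
  unfolding D2_def
  by (subst D1_scale[OF open_interior, where r = "1 / t" and s = 0 and S1 = K])
     (auto intro: D1_diff scale_interior simp: D1_scale_F power2_eq_square)

lemma D1_self: "x \<in> interior K \<Longrightarrow> D1 F x x = - \<nu>"
  by (rule D1_radial[where \<phi> = "\<lambda>t. F x - \<nu> * ln t"])
     (auto intro!: F_diff derivative_eq_intros simp: log_homogeneous)

lemma D2_self: "x \<in> interior K \<Longrightarrow> D2 F x h x = - D1 F x h"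
  unfolding D2_def
  by (rule D1_radial[where \<phi> = "\<lambda>t. 1 / t * D1 F x h"])
     (auto intro!: D1_diff derivative_eq_intros simp: D1_scale_F)

lemma D3_self: "x \<in> interior K \<Longrightarrow> D3 F x h k x = - 2 * D2 F x h k"
  unfolding D3_def
  by (rule D1_radial[where \<phi> = "\<lambda>t. 1 / t\<^sup>2 * D2 F x h k"])
     (auto intro!: D2_diff derivative_eq_intros simp: D2_scale_F)

lemma inner_H_self: "x \<in> interior K \<Longrightarrow> H x x \<bullet> h = - D1 F x h"
  by (metis D2_self D2_sym inner_H)

lemma H'_self: assumes x: "x \<in> interior K" shows "H' x h x = - 2 *\<^sub>R H x h"
proof -
  have "H' x h x \<bullet> l = (- 2 *\<^sub>R H x h) \<bullet> l" for l
    using D3_swap12[OF x, of x l h] D3_swap23[OF x, of l x h] D3_self[OF x, of l h]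
      D2_sym[OF x, of l h] by (simp add: inner_H'[OF x] inner_H[OF x])
  then show ?thesis by (metis vector_eq_rdot)
qed

text \<open>Semidefiniteness comes from the bound on the first derivative by the second: its constant \<open>\<mu>\<close> is
positive, as the bound at \<open>h = x\<close> reads \<open>\<nu>\<^sup>2 \<le> \<mu> \<nu>\<close>. Non-singularity makes the form definite.\<close>

lemma H_pos_def: assumes x: "x \<in> interior K" and u: "u \<noteq> 0" shows "H x u \<bullet> u > 0"
proof -
  obtain \<mu> where \<mu>: "\<And>h. \<bar>D1 F x h\<bar>\<^sup>2 \<le> \<mu> * D2 F x h h"
    using barrier x unfolding self_concordant_barrier_def by blast
  have "\<nu> * \<nu> \<le> \<mu> * \<nu>"
    using \<mu>[of x] by (simp add: D1_self[OF x] D2_self[OF x] power2_eq_square)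
  then have "\<mu> > 0" using \<nu>_pos by simp
  have psd: "H x h \<bullet> h \<ge> 0" for h
    using order_trans[OF zero_le_power2 \<mu>[of h]] \<open>\<mu> > 0\<close> by (simp add: inner_H[OF x] zero_le_mult_iff)
  moreover have "H x u \<bullet> u \<noteq> 0"
  proof
    assume "H x u \<bullet> u = 0"
    then have "H x u = 0" by (rule psd_null_vector[OF H_linear[OF x] H_sym[OF x] psd])
    then show False
      using u hess_bij[OF x] linear_0[OF H_linear[OF x]] by (metis bij_is_inj injD)
  qed
  ultimately show ?thesis by (metis less_eq_real_def)
qed

text \<open>Convexity on the segment from \<open>w\<close> to \<open>y\<close> bounds the difference quotients of \<open>F\<close> at \<open>w\<close>, whose limit is
the directional derivative.\<close>

lemma tangent_le:
  assumes w: "w \<in> interior K" and y: "y \<in> interior K"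
  shows "F w + D1 F w (y - w) \<le> F y"
proof -
  let ?d = "y - w"
  have "((\<lambda>t. w + t *\<^sub>R ?d) has_derivative (\<lambda>r. r *\<^sub>R ?d)) (at (0::real))" by (auto intro!: derivative_eq_intros)
  moreover have "(F has_derivative D1 F w) (at (w + 0 *\<^sub>R ?d))" using D1_works[OF F_diff[OF w]] by simp
  ultimately have "((\<lambda>t. F (w + t *\<^sub>R ?d)) has_derivative (\<lambda>r. D1 F w (r *\<^sub>R ?d))) (at (0::real))"
    by (rule has_derivative_compose)
  then have "((\<lambda>t. F (w + t *\<^sub>R ?d)) has_real_derivative D1 F w ?d) (at 0)"
    by (rule has_derivative_imp_has_field_derivative) (simp add: linear_cmul[OF linear_D1[OF F_diff[OF w]]])
  then have lim: "((\<lambda>t. (F (w + t *\<^sub>R ?d) - F w) / t) \<longlongrightarrow> D1 F w ?d) (at_right 0)"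
    by (simp add: DERIV_def filterlim_at_split)
  have ev: "\<forall>\<^sub>F t in at_right 0. (F (w + t *\<^sub>R ?d) - F w) / t \<le> F y - F w"
    unfolding eventually_at_right_field
  proof (intro exI[of _ 1] conjI allI impI)
    fix t :: real assume t: "0 < t" "t < 1"
    have cv: "convex_on (interior K) F" using barrier by (simp add: self_concordant_barrier_def)
    have "w + t *\<^sub>R ?d = (1 - t) *\<^sub>R w + t *\<^sub>R y" by (simp add: algebra_simps)
    then have "F (w + t *\<^sub>R ?d) \<le> (1 - t) * F w + t * F y"
      using convex_onD[OF cv, of t w y] t w y by simp
    then show "(F (w + t *\<^sub>R ?d) - F w) / t \<le> F y - F w"
      using t by (simp add: field_simps)
  qed simp
  have "D1 F w ?d \<le> F y - F w"
    by (rule tendsto_le[OF trivial_limit_at_right_real tendsto_const lim ev])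
  then show ?thesis by simp
qed

lemma frontier_blowup:
  assumes "\<And>n. X n \<in> interior K" "X \<longlonglongrightarrow> x" "x \<in> K" "x \<notin> interior K"
  shows "filterlim (\<lambda>n. F (X n)) at_top sequentially"
proof -
  have "x \<in> frontier K" using assms by (simp add: frontier_def closure_subset[THEN subsetD])
  then show ?thesis using barrier assms unfolding self_concordant_barrier_def by blast
qed

lemma not_blowup_of_bounded:
  fixes f :: "nat \<Rightarrow> real"
  assumes "filterlim f at_top sequentially" and "\<forall>\<^sub>F n in sequentially. f n \<le> C"
  shows False
proof -
  have "\<forall>\<^sub>F n in sequentially. C + 1 \<le> f n" using assms(1) unfolding filterlim_at_top by blast
  with assms(2) have "\<forall>\<^sub>F n in sequentially. False" by eventually_elim simp
  then show False by simp
qed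

text \<open>The scaling point of \<open>x\<close> and \<open>s\<close> is found as a minimiser of \<open>\<psi> w = \<langle>s, w\<rangle> - D1 F w x\<close>, whose gradient is
\<open>s - H w x\<close>. A minimiser exists because the sublevel sets of \<open>\<psi>\<close> are compact: they are bounded, since
the first term grows linearly on \<open>K\<close> and the second is non-negative, and they stay away from the
boundary, since there \<open>- D1 F w x\<close> is at least \<open>F w\<close> up to a constant.\<close>

lemma scaling_point:
  assumes x: "x \<in> interior K" and s: "s \<in> interior (dual_cone K)"
  shows "\<exists>w\<in>interior K. H w x = s"
proof -
  define \<psi> where "\<psi> = (\<lambda>w. s \<bullet> w - D1 F w x)"
  define S where "S = {w \<in> interior K. \<psi> w \<le> \<psi> x}"
  obtain c where c: "c > 0" "\<And>y. y \<in> dual_cone (dual_cone K) \<Longrightarrow> c * norm y \<le> s \<bullet> y"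
    using interior_inner_bound[OF s] by blast
  have cK: "c * norm w \<le> s \<bullet> w" if "w \<in> interior K" for w
    using that interior_subset[of K] by (intro c(2)) (auto simp: dual_cone_wrt_def inner_commute)
  have D1_neg: "D1 F w x \<le> 0" if w: "w \<in> interior K" for w
  proof -
    have "H w w \<in> dual_cone K" using hess_dual[OF w w] interior_subset by blast
    then have "0 \<le> x \<bullet> H w w" using x interior_subset by (auto simp: dual_cone_wrt_def)
    then show ?thesis using inner_H_self[OF w, of x] by (simp add: inner_commute)
  qed
  have d\<psi>: "(\<psi> has_derivative (\<lambda>h. s \<bullet> h - H w x \<bullet> h)) (at w)" if w: "w \<in> interior K" for w
    unfolding \<psi>_def inner_H[OF w] D2_def
    by (intro derivative_intros D1_works D1_diff w)
  have bnd: "norm w \<le> \<psi> x / c" if "w \<in> S" for w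
    using that cK[of w] D1_neg[of w] c(1) by (auto simp: S_def \<psi>_def pos_le_divide_eq mult.commute)
  have F_bnd: "F w \<le> \<psi> x + F x" if "w \<in> S" for w
  proof -
    have w: "w \<in> interior K" "\<psi> w \<le> \<psi> x" using that by (auto simp: S_def)
    have "0 \<le> s \<bullet> w" using cK[OF w(1)] c(1) by (meson mult_nonneg_nonneg norm_ge_zero order_trans less_imp_le)
    then show ?thesis
      using tangent_le[OF w(1) x] w(2) D1_self[OF w(1)] \<nu>_pos
      by (simp add: linear_diff[OF linear_D1[OF F_diff[OF w(1)]]] \<psi>_def)
  qed
  have "closed S"
    unfolding closed_sequential_limits
  proof (intro allI impI, elim conjE)
    fix X w assume X: "\<forall>n. X n \<in> S" "X \<longlonglongrightarrow> w"
    have Xi: "X n \<in> interior K" for n using X(1) by (simp add: S_def)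
    have "w \<in> K" using closed_sequentially[OF cone_facts(2) _ X(2)] Xi interior_subset by blast
    have w: "w \<in> interior K"
    proof (rule ccontr)
      assume "w \<notin> interior K"
      then show False
        using not_blowup_of_bounded[OF frontier_blowup[OF Xi X(2) \<open>w \<in> K\<close>], of "\<psi> x + F x"] F_bnd X(1) by simp
    qed
    have "isCont \<psi> w" using has_derivative_continuous[OF d\<psi>[OF w]] .
    then have "(\<lambda>n. \<psi> (X n)) \<longlonglongrightarrow> \<psi> w" using X(2) by (rule isCont_tendsto_compose)
    then have "\<psi> w \<le> \<psi> x" by (rule tendsto_upperbound) (use X(1) in \<open>auto simp: S_def\<close>)
    with w show "w \<in> S" by (simp add: S_def)
  qed
  moreover have "bounded S" using bnd by (auto simp: bounded_iff)
  ultimately have "compact S" by (simp add: compact_eq_bounded_closed)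
  moreover have "x \<in> S" using x by (simp add: S_def)
  moreover have "continuous_on S \<psi>"
    using d\<psi> by (intro continuous_at_imp_continuous_on) (auto simp: S_def intro: has_derivative_continuous)
  ultimately obtain w where w: "w \<in> S" and min: "\<And>v. v \<in> S \<Longrightarrow> \<psi> w \<le> \<psi> v"
    using continuous_attains_inf[of S \<psi>] by blast
  have wi: "w \<in> interior K" using w by (simp add: S_def)
  have "\<psi> w \<le> \<psi> v" if "v \<in> interior K" for v
    using min[of v] w that by (cases "\<psi> v \<le> \<psi> x") (auto simp: S_def)
  then have "(\<lambda>h. s \<bullet> h - H w x \<bullet> h) = (\<lambda>h. 0)"
    by (intro differential_zero_maxmin[OF wi open_interior d\<psi>[OF wi]]) blast
  then have "H w x \<bullet> h = s \<bullet> h" for h by (metis eq_iff_diff_eq_0)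
  then have "H w x = s" by (metis vector_eq_rdot)
  with wi show ?thesis by blast
qed

lemma conjugate_antimono:
  assumes "a - b \<in> dual_cone K"
  shows "conjugate_barrier K F a \<le> conjugate_barrier K F b"
  unfolding conjugate_barrier_def
proof (rule SUP_mono)
  fix y assume y: "y \<in> interior K"
  then have "0 \<le> y \<bullet> (a - b)" using assms interior_subset by (auto simp: dual_cone_wrt_def)
  then have "- (y \<bullet> a) - F y \<le> - (y \<bullet> b) - F y" by (simp add: inner_diff_right)
  with y show "\<exists>m\<in>interior K. ereal (- (y \<bullet> a) - F y) \<le> ereal (- (m \<bullet> b) - F m)"
    by (intro bexI[of _ y]) simp_all
qed

text \<open>The image is open in the interior of the dual cone, which is connected, so it is enough that the
image is relatively closed. If \<open>H w (X n)\<close> converges to an interior dual point \<open>s\<close> while \<open>X n\<close> converges to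
the boundary of \<open>K\<close>, then \<open>F (X n)\<close>, and with it the conjugate barrier at \<open>H w (X n)\<close>, tends to infinity.
But the conjugate is bounded near \<open>s\<close> by its finite value at \<open>s / 2\<close>, because it decreases along
the dual cone.\<close>

lemma H_image:
  assumes w: "w \<in> interior K"
  shows "H w ` interior K = interior (dual_cone K)"
proof -
  let ?O = "interior (dual_cone K)" and ?A = "H w ` interior K"
  have sub: "?A \<subseteq> ?O" using hess_dual w by auto
  have "open ?A"
    by (simp add: open_bijective_linear_image_eq[OF H_linear[OF w] hess_bij[OF w]])
  have clo: "s \<in> ?A" if s: "s \<in> ?O" "s \<in> closure ?A" for s
  proof (rule ccontr)
    assume nA: "s \<notin> ?A"
    obtain a where a: "\<And>n. a n \<in> ?A" "a \<longlonglongrightarrow> s" using s(2) closure_sequential by metis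
    then have "\<forall>n. \<exists>y. y \<in> interior K \<and> a n = H w y" by blast
    then obtain X where X: "\<And>n. X n \<in> interior K" "\<And>n. a n = H w (X n)" by metis
    let ?G = "inv (H w)"
    have G: "linear ?G" by (rule inj_linear_imp_inv_linear[OF H_linear[OF w] bij_is_inj[OF hess_bij[OF w]]])
    have GX: "?G (a n) = X n" for n by (simp add: X(2) inv_f_f[OF bij_is_inj[OF hess_bij[OF w]]])
    have "(\<lambda>n. ?G (a n)) \<longlonglongrightarrow> ?G s"
      using isCont_tendsto_compose[OF linear_continuous_at a(2)] G by (simp add: linear_conv_bounded_linear)
    then have lim: "X \<longlonglongrightarrow> ?G s" by (simp add: GX)
    have HG: "H w (?G s) = s" by (simp add: bij_is_surj[OF hess_bij[OF w]] surj_f_inv_f)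
    have inK: "?G s \<in> K" using closed_sequentially[OF cone_facts(2) _ lim] X(1) interior_subset by blast
    have nint: "?G s \<notin> interior K" using nA HG by (metis image_eqI)
    obtain v where v: "v \<in> interior K" "H v w = s" using scaling_point[OF w s(1)] by blast
    \<comment> \<open>the Hessian is homogeneous of degree \<open>- 2\<close>, so this is the scaling point for \<open>s / 2\<close>\<close>
    define v' where "v' = sqrt 2 *\<^sub>R v"
    have v': "v' \<in> interior K" unfolding v'_def by (rule scale_interior[OF v(1)]) simp
    have Hv': "H v' w = (1 / 2) *\<^sub>R s"
    proof -
      have "H v' w \<bullet> h = ((1 / 2) *\<^sub>R s) \<bullet> h" for h
        using D2_scale_F[OF v(1), of "sqrt 2" w h] v
        by (simp add: inner_H[OF v'] inner_H[OF v(1), symmetric] v'_def[symmetric])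
      then show ?thesis by (metis vector_eq_rdot)
    qed
    have half: "(1 / 2) *\<^sub>R s \<in> ?O" using hess_dual[OF w v'] by (simp add: Hv')
    have "(\<lambda>n. a n - (1 / 2) *\<^sub>R s) \<longlonglongrightarrow> s - (1 / 2) *\<^sub>R s" by (intro tendsto_intros a)
    also have "s - (1 / 2) *\<^sub>R s = (1 / 2) *\<^sub>R s" by (simp add: scaleR_left_diff_distrib[symmetric, of 1, simplified])
    finally have "\<forall>\<^sub>F n in sequentially. a n - (1 / 2) *\<^sub>R s \<in> ?O"
      using half by (intro topological_tendstoD) auto
    then have "\<forall>\<^sub>F n in sequentially. F (X n) \<le> F w - 2 * F v' + 2 * F w"
    proof eventually_elim
      case (elim n)
      have "conjugate_barrier K F (H w (X n)) \<le> conjugate_barrier K F (H v' w)"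
        using elim interior_subset by (intro conjugate_antimono) (auto simp: X(2) Hv')
      then show ?case by (simp add: hess_conjugate X w v')
    qed
    with frontier_blowup[OF X(1) lim inK nint] show False by (rule not_blowup_of_bounded)
  qed
  have "connected ?O" by (intro convex_connected convex_interior convex_dual_cone)
  moreover have "openin (top_of_set ?O) ?A" using \<open>open ?A\<close> sub by (simp add: openin_open_eq)
  moreover have "closedin (top_of_set ?O) ?A"
    unfolding closedin_closed using clo sub closure_subset[of ?A] by (intro exI[of _ "closure ?A"]) auto
  ultimately have "?A = {} \<or> ?A = ?O" unfolding connected_clopen by blast
  then show ?thesis using cone_facts(3) by auto
qed

lemma quotient_automorphism:
  assumes x: "x \<in> interior K" and w: "w \<in> interior K" and Q: "linear Q" "\<And>k. H x (Q k) = H w k"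
  shows "bij Q" "Q ` interior K = interior K" "Q ` K = K"
proof -
  have inj: "inj Q"
  proof (rule injI)
    fix u v assume "Q u = Q v"
    then have "H w u = H w v" by (metis Q(2))
    then show "u = v" using bij_is_inj[OF hess_bij[OF w]] by (simp add: inj_eq)
  qed
  then show "bij Q" using linear_injective_imp_surjective[OF Q(1)] by (simp add: bij_def)
  have "H x ` (Q ` interior K) = H x ` interior K"
    by (simp add: image_image Q(2) H_image x w)
  then show int: "Q ` interior K = interior K"
    by (simp add: inj_image_eq_iff[OF bij_is_inj[OF hess_bij[OF x]]])
  have K: "closure (interior K) = K"
    using convex_closure_interior[OF cone_facts(4,3)] cone_facts(2) by simp
  show "Q ` K = K"
    using closure_injective_linear_image[OF Q(1) inj, of "interior K"] by (simp add: int K)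
qed

lemma quotient_exists:
  assumes "x \<in> interior K" "w \<in> interior K"
  obtains Q where "linear Q" "\<And>k. H x (Q k) = H w k"
proof
  show "linear (inv (H x) \<circ> H w)"
    by (intro linear_compose H_linear assms inj_linear_imp_inv_linear bij_is_inj hess_bij)
  show "H x ((inv (H x) \<circ> H w) k) = H w k" for k
    using hess_bij[OF assms(1)] by (simp add: bij_is_surj surj_f_inv_f)
qed

text \<open>The automorphism taking \<open>e\<close> to \<open>x\<close> comes from the scaling point \<open>w\<close> with \<open>H w e = H e x\<close>.\<close>

lemma quotients_transitive:
  assumes e: "e \<in> interior K" and x: "x \<in> interior K"
  obtains w Q where "w \<in> interior K" "linear Q" "\<And>k. H e (Q k) = H w k" "Q e = x"
proof -
  obtain w where w: "w \<in> interior K" "H w e = H e x" using scaling_point[OF e hess_dual[OF x e]] by blast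
  obtain Q where Q: "linear Q" "\<And>k. H e (Q k) = H w k" using quotient_exists[OF e w(1)] by blast
  have "H e (Q e) = H e x" by (simp add: Q(2) w(2))
  then have "Q e = x" using bij_is_inj[OF hess_bij[OF e]] by (simp add: inj_eq)
  with w(1) Q show ?thesis by (rule that)
qed

subsection \<open>Comparison with the characteristic function\<close>

text \<open>Equivariance of \<open>ln \<phi>\<close> under automorphisms of \<open>K\<close> is differentiated twice to obtain the hypotheses of
the rigidity lemma; the resulting constant operator is scalar by irreducibility, and the relation
between the Hessians is integrated by means of homogeneity.\<close>

lemma log_char_fun_proportional:
  assumes irr: "irreducible_cone K"
  shows "\<exists>r>0. \<exists>c. \<forall>x\<in>interior K. ln (char_fun K x) = r * F x + c"
proof -
  let ?U = "\<lambda>x. ln (char_fun K x)"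
  obtain e where e: "e \<in> interior K" using cone_facts(3) by blast
  have L: "interior (dual_cone K) \<noteq> {}" using hess_dual[OF e e] by blast
  obtain g M M' where
    dU: "\<And>x. x \<in> interior K \<Longrightarrow> (?U has_derivative (\<lambda>h. g x \<bullet> h)) (at x)" and
    dg: "\<And>x. x \<in> interior K \<Longrightarrow> (g has_derivative M x) (at x)" and
    M_sym: "\<And>x u v. x \<in> interior K \<Longrightarrow> M x u \<bullet> v = u \<bullet> M x v" and
    dM: "\<And>x k. x \<in> interior K \<Longrightarrow> ((\<lambda>y. M y k) has_derivative (\<lambda>h. M' x h k)) (at x)" and
    M'_swap: "\<And>x h k. x \<in> interior K \<Longrightarrow> M' x h k = M' x k h" and
    g_neg: "\<And>x. x \<in> interior K \<Longrightarrow> g x \<bullet> x < 0"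
    using log_char_fun_derivatives[OF L] by blast
  have g_aut: "g (A z) \<bullet> A h = g z \<bullet> h"
    if A: "linear A" "bij A" "A ` K = K" and z: "z \<in> interior K" for A z h
  proof -
    have inA: "A y \<in> interior K" if "y \<in> interior K" for y
      using char_fun_automorphism_ratio(1)[OF A that e] .
    have U: "?U (A y) = ?U y + (?U (A e) - ?U e)" if y: "y \<in> interior K" for y
    proof -
      note pos = char_fun_pos[OF y L] char_fun_pos[OF e L] char_fun_pos[OF inA[OF y] L] char_fun_pos[OF inA[OF e] L]
      from arg_cong[where f = ln, OF char_fun_automorphism_ratio(2)[OF A y e]] pos
      show ?thesis by (simp add: ln_mult)
    qed
    have "(A has_derivative A) (at z)"
      using A(1) by (simp add: linear_imp_has_derivative)
    from has_derivative_compose[OF this dU[OF inA[OF z]]]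
    have "((\<lambda>y. ?U y + (?U (A e) - ?U e)) has_derivative (\<lambda>h. g (A z) \<bullet> A h)) (at z)"
      by (rule has_derivative_transform_within_open[OF _ open_interior z]) (rule U)
    moreover have "((\<lambda>y. ?U y + (?U (A e) - ?U e)) has_derivative (\<lambda>h. g z \<bullet> h)) (at z)"
      using has_derivative_add[OF dU[OF z] has_derivative_const] by simp
    ultimately show ?thesis using has_derivative_unique by metis
  qed
  have M_aut: "M (A z) (A k) \<bullet> A h = M z k \<bullet> h"
    if A: "linear A" "bij A" "A ` K = K" and z: "z \<in> interior K" for A z h k
  proof -
    have Az: "A z \<in> interior K" using char_fun_automorphism_ratio(1)[OF A z e] .
    have "(A has_derivative A) (at z)" using A(1) by (simp add: linear_imp_has_derivative)
    from has_derivative_inner_left[OF has_derivative_compose[OF this dg[OF Az]], of "A h"]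
    have "((\<lambda>y. g y \<bullet> h) has_derivative (\<lambda>k. M (A z) (A k) \<bullet> A h)) (at z)"
      by (rule has_derivative_transform_within_open[OF _ open_interior z]) (rule g_aut[OF A])
    moreover have "((\<lambda>y. g y \<bullet> h) has_derivative (\<lambda>k. M z k \<bullet> h)) (at z)"
      by (rule has_derivative_inner_left[OF dg[OF z]])
    ultimately show ?thesis using has_derivative_unique by metis
  qed
  have M_self: "M x x = - g x" if x: "x \<in> interior K" for x
  proof -
    have scale: "g (t *\<^sub>R x) \<bullet> h = 1 / t * (g x \<bullet> h)" if t: "t > 0" for t h
    proof -
      from g_aut[OF linear_scaleR scaling_automorphism[OF t] x, of h] show ?thesis using t by (simp add: field_simps)
    qed
    have "D1 (\<lambda>y. g y \<bullet> h) x x = - (g x \<bullet> h)" for h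
    proof (rule D1_radial[where \<phi> = "\<lambda>t. 1 / t * (g x \<bullet> h)"])
      show "(\<lambda>y. g y \<bullet> h) differentiable (at x)"
        using has_derivative_inner_left[OF dg[OF x]] by (rule differentiableI)
      show "((\<lambda>t. 1 / t * (g x \<bullet> h)) has_real_derivative - (g x \<bullet> h)) (at 1)"
        by (auto intro!: derivative_eq_intros)
    qed (rule scale)
    then have "M x x \<bullet> h = (- g x) \<bullet> h" for h
      by (simp add: D1_unique[OF has_derivative_inner_left[OF dg[OF x]]])
    then show ?thesis by (metis vector_eq_rdot)
  qed
  have "\<exists>T. linear T \<and> (\<forall>x\<in>interior K. \<forall>k. M x k = H x (T k))"
  proof (rule hessian_quotient_constant[where H = H and H' = H' and M' = M', OF open_interior cone_facts(5,3)])
    fix x w z Q assume xwz: "x \<in> interior K" "w \<in> interior K" "z \<in> interior K" and Q: "linear Q" "\<And>k. H x (Q k) = H w k"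
    note aut = quotient_automorphism[OF xwz(1,2) Q]
    show "Q z \<in> interior K \<and> (\<forall>k l. M (Q z) (Q k) \<bullet> Q l = M z k \<bullet> l)"
      using aut(2) xwz(3) M_aut[OF Q(1) aut(1,3) xwz(3)] by auto
  qed (fact H_linear hess_bij H_sym has_derivative_linear[OF dg] M_sym H_has_derivative dM H'_swap H'_sym M'_swap H'_self)+
  then obtain T where T: "linear T" "\<And>x k. x \<in> interior K \<Longrightarrow> M x k = H x (T k)" by blast
  have "\<exists>r. \<forall>x. T x = r *\<^sub>R x"
  proof (rule irreducible_cone_commutant_scalar[OF irr cone_facts(2) e H_linear[OF e] H_sym[OF e] H_pos_def[OF e] T(1)])
    show T_sa: "H e (T u) \<bullet> v = H e u \<bullet> T v" for u v
      using M_sym[OF e, of u v] by (simp add: T(2)[OF e] H_sym[OF e])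
    fix x assume x: "x \<in> interior K"
    obtain w Q where Q: "w \<in> interior K" "linear Q" "\<And>k. H e (Q k) = H w k" "Q e = x"
      using quotients_transitive[OF e x] by blast
    have "Q (T v) = T (Q v)" for v
    proof -
      have "H e (T (Q v)) \<bullet> l = H e (Q (T v)) \<bullet> l" for l
      proof -
        have "H e (T (Q v)) \<bullet> l = H w v \<bullet> T l" by (simp add: T_sa Q(3))
        also have "\<dots> = v \<bullet> M w l" by (simp add: H_sym[OF Q(1)] T(2)[OF Q(1)])
        also have "\<dots> = M w v \<bullet> l" by (simp only: M_sym[OF Q(1)])
        also have "\<dots> = H e (Q (T v)) \<bullet> l" by (simp add: T(2)[OF Q(1)] Q(3))
        finally show ?thesis .
      qed
      then have "H e (T (Q v)) = H e (Q (T v))" by (metis vector_eq_rdot)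
      then show ?thesis using bij_is_inj[OF hess_bij[OF e]] by (simp add: inj_eq)
    qed
    then show "\<exists>Q. linear Q \<and> Q ` interior K \<subseteq> interior K \<and> Q e = x \<and> (\<forall>v. Q (T v) = T (Q v))"
      using quotient_automorphism(2)[OF e Q(1,2,3)] Q by (intro exI[of _ Q]) auto
  qed
  then obtain r where r: "\<And>x. T x = r *\<^sub>R x" by blast
  have gF: "g x \<bullet> h = r * D1 F x h" if x: "x \<in> interior K" for x h
  proof -
    have "g x = - (r *\<^sub>R H x x)"
      using M_self[OF x] T(2)[OF x, of x] by (simp add: r linear_cmul[OF H_linear[OF x]])
    then show ?thesis by (simp add: inner_H_self[OF x])
  qed
  have "r > 0"
    using g_neg[OF e] gF[OF e, of e] \<nu>_pos by (simp add: D1_self[OF e] mult_pos_neg zero_less_mult_iff)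
  moreover have "\<exists>c. \<forall>x\<in>interior K. ?U x - r * F x = c"
  proof (rule has_derivative_zero_constant[OF cone_facts(5)])
    fix x assume x: "x \<in> interior K"
    have "((\<lambda>x. ?U x - r * F x) has_derivative (\<lambda>h. g x \<bullet> h - r * D1 F x h)) (at x)"
      by (intro derivative_intros dU D1_works F_diff x)
    then show "((\<lambda>x. ?U x - r * F x) has_derivative (\<lambda>h. 0)) (at x within interior K)"
      by (simp add: gF[OF x] has_derivative_at_withinI)
  qed
  then obtain c where "\<And>x. x \<in> interior K \<Longrightarrow> ?U x - r * F x = c" by blast
  then have "\<forall>x\<in>interior K. ?U x = r * F x + c" by (auto simp: algebra_simps)
  ultimately show ?thesis by blast
qed

end

theorem theorem5p4:
  fixes K :: "'a::euclidean_space set" and F :: "'a \<Rightarrow> real" and c1 c2 :: real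
  assumes "symmetric_cone K" and "irreducible_cone K"
    and "self_scaled_barrier K F"
    and "c1 > 0"
  shows "\<exists>\<alpha> \<beta>::real. \<alpha> > 0 \<and>
    (\<forall>x\<in>interior K. F x = \<alpha> * universal_barrier c1 c2 K x + \<beta>)"
proof -
  obtain \<nu> where \<nu>: "self_scaled_cone K F \<nu>"
    using assms(1,3) unfolding self_scaled_barrier_def symmetric_cone_def self_scaled_cone_def by blast
  obtain r c where r: "r > 0" and eq: "\<And>x. x \<in> interior K \<Longrightarrow> ln (char_fun K x) = r * F x + c"
    using self_scaled_cone.log_char_fun_proportional[OF \<nu> assms(2)] by blast
  have "F x = (1 / (r * c1)) * universal_barrier c1 c2 K x + (- (c2 / (r * c1)) - c / r)" if "x \<in> interior K" for x
    using r assms(4) by (simp add: universal_barrier_def eq[OF that] field_simps)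
  moreover have "1 / (r * c1) > 0" using r assms(4) by simp
  ultimately show ?thesis by blast
qed

end
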